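(* Let $(A,\|\cdot\|)$ be a weakly regular, functionally continuous, uniform normed algebra with unit. Let $|\cdot|$ be an algebra norm on $A$. (1) If $|\cdot|$ is functionally continuous, then $\|x\|\le|x|$ for all $x\in A$. (2) If $|\cdot|$ is semisimple, then $|\cdot|$ is functionally continuous (and hence $\|x\|\le|x|$ for all $x\in A$ by (1)). If, further, $|\cdot|$ is continuous on $(A,\|\cdot\|)$, then $|\cdot|$ is equivalent to $\|\cdot\|$. (3) If $|\cdot|$ is uniform, i.e. $|x^2|=|x|^2$ for all $x\in A$, then $|\cdot|=\|\cdot\|$.
   Context: Algebras are associative over $\mathbb{C}$. A normed algebra is an algebra with a submultiplicative norm (not necessarily complete); an algebra norm on $A$ is a norm making $A$ a normed algebra. A uniform normed algebra is a normed algebra $(A,\|\cdot\|)$ with $\|x^2\|=\|x\|^2$ for all $x\in A$. For a normed algebra $A$, $M^*(A)$ denotes the set of all nonzero multiplicative linear functionals $A\to\mathbb{C}$, and $M(A)$ the subset of those that are continuous, endowed with the weak-$*$ (Gelfand) topology of pointwise convergence on $A$. A normed algebra $A$ is functionally continuous if $M^*(A)=M(A)$; it is weakly regular if for every closed subset $F\subset M(A)$ with $F\neq M(A)$, there exists a nonzero $x\in A$ such that $f(x)=0$ for all $f\in F$. An algebra norm $|\cdot|$ on $A$ is functionally continuous if the normed algebra $(A,|\cdot|)$ is functionally continuous; it is semisimple if the completion of $(A,|\cdot|)$ is a semisimple algebra (zero Jacobson radical). *)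

theory Defs
  imports "HOL-Analysis.Analysis" "HOL-Algebra.QuotRing"
begin

locale complex_algebra = vector_space smul
  for smul :: "complex \<Rightarrow> 'a::ring_1 \<Rightarrow> 'a" +
  assumes smul_mult_left: "smul c x * y = smul c (x * y)"
    and smul_mult_right: "x * smul c y = smul c (x * y)"

text \<open>The norm of the unit is not required to be 1.\<close>

locale algebra_norm = complex_algebra smul
  for smul :: "complex \<Rightarrow> 'a::ring_1 \<Rightarrow> 'a" +
  fixes p :: "'a \<Rightarrow> real"
  assumes nonneg: "0 \<le> p x"
    and eq_zero_iff: "p x = 0 \<longleftrightarrow> x = 0"
    and triangle: "p (x + y) \<le> p x + p y"
    and homogeneous: "p (smul c x) = cmod c * p x"
    and submultiplicative: "p (x * y) \<le> p x * p y"

definition uniform_norm :: "('a::ring_1 \<Rightarrow> real) \<Rightarrow> bool"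
  where "uniform_norm p \<longleftrightarrow> (\<forall>x. p (x * x) = (p x)\<^sup>2)"

definition norm_dist :: "('a::ring_1 \<Rightarrow> real) \<Rightarrow> 'a \<Rightarrow> 'a \<Rightarrow> real"
  where "norm_dist p x y = p (x - y)"

definition norm_topology :: "('a::ring_1 \<Rightarrow> real) \<Rightarrow> 'a topology"
  where "norm_topology p = Metric_space.mtopology UNIV (norm_dist p)"

definition equivalent_norms :: "('a \<Rightarrow> real) \<Rightarrow> ('a \<Rightarrow> real) \<Rightarrow> bool"
  where "equivalent_norms p q \<longleftrightarrow>
    (\<exists>c>0. \<exists>C>0. \<forall>x. c * p x \<le> q x \<and> q x \<le> C * p x)"

text \<open>For the normed algebra $(A,p)$, these are the sets $M^*(A)$ and $M(A)$.\<close>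

definition characters :: "(complex \<Rightarrow> 'a::ring_1 \<Rightarrow> 'a) \<Rightarrow> ('a \<Rightarrow> complex) set"
  where "characters smul =
    {f. Vector_Spaces.linear smul (*) f \<and> (\<forall>x y. f (x * y) = f x * f y) \<and> (\<exists>x. f x \<noteq> 0)}"

definition continuous_characters ::
    "(complex \<Rightarrow> 'a::ring_1 \<Rightarrow> 'a) \<Rightarrow> ('a \<Rightarrow> real) \<Rightarrow> ('a \<Rightarrow> complex) set"
  where "continuous_characters smul p =
    {f \<in> characters smul. continuous_map (norm_topology p) euclidean f}"

definition gelfand_topology ::
    "(complex \<Rightarrow> 'a::ring_1 \<Rightarrow> 'a) \<Rightarrow> ('a \<Rightarrow> real) \<Rightarrow> ('a \<Rightarrow> complex) topology"
  where "gelfand_topology smul p =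
    subtopology (product_topology (\<lambda>_. euclidean) UNIV) (continuous_characters smul p)"

definition functionally_continuous ::
    "(complex \<Rightarrow> 'a::ring_1 \<Rightarrow> 'a) \<Rightarrow> ('a \<Rightarrow> real) \<Rightarrow> bool"
  where "functionally_continuous smul p \<longleftrightarrow>
    characters smul = continuous_characters smul p"

definition weakly_regular ::
    "(complex \<Rightarrow> 'a::ring_1 \<Rightarrow> 'a) \<Rightarrow> ('a \<Rightarrow> real) \<Rightarrow> bool"
  where "weakly_regular smul p \<longleftrightarrow>
    (\<forall>F. closedin (gelfand_topology smul p) F \<and> F \<noteq> continuous_characters smul p \<longrightarrow>
      (\<exists>x. x \<noteq> 0 \<and> (\<forall>f\<in>F. f x = 0)))"

text \<open>The completion is the ring of Cauchy sequences modulo the ideal of null sequences. Its norm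
  and scalar multiplication are not recorded: the Jacobson radical depends only on the ring
  structure, because one-sided ideals of a unital algebra are automatically linear subspaces.\<close>

definition cauchy_ring :: "('a::ring_1 \<Rightarrow> real) \<Rightarrow> (nat \<Rightarrow> 'a) ring"
  where "cauchy_ring p =
    \<lparr>carrier = {s. Metric_space.MCauchy UNIV (norm_dist p) s},
     mult = (\<lambda>s t n. s n * t n), one = (\<lambda>_. 1),
     zero = (\<lambda>_. 0), add = (\<lambda>s t n. s n + t n)\<rparr>"

definition null_sequences :: "('a::ring_1 \<Rightarrow> real) \<Rightarrow> (nat \<Rightarrow> 'a) set"
  where "null_sequences p = {s. (\<lambda>n. p (s n)) \<longlonglongrightarrow> 0}"

definition completion :: "('a::ring_1 \<Rightarrow> real) \<Rightarrow> (nat \<Rightarrow> 'a) set ring"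
  where "completion p = cauchy_ring p Quot null_sequences p"

definition left_ideal :: "'b set \<Rightarrow> ('b, 'm) ring_scheme \<Rightarrow> bool"
  where "left_ideal I R \<longleftrightarrow>
    additive_subgroup I R \<and> (\<forall>r\<in>carrier R. \<forall>a\<in>I. r \<otimes>\<^bsub>R\<^esub> a \<in> I)"

definition maximal_left_ideal :: "'b set \<Rightarrow> ('b, 'm) ring_scheme \<Rightarrow> bool"
  where "maximal_left_ideal I R \<longleftrightarrow>
    left_ideal I R \<and> I \<noteq> carrier R \<and>
    (\<forall>J. left_ideal J R \<and> I \<subseteq> J \<longrightarrow> J = I \<or> J = carrier R)"

definition jacobson_radical :: "('b, 'm) ring_scheme \<Rightarrow> 'b set"
  where "jacobson_radical R =
    {x \<in> carrier R. \<forall>I. maximal_left_ideal I R \<longrightarrow> x \<in> I}"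

definition semisimple_norm :: "('a::ring_1 \<Rightarrow> real) \<Rightarrow> bool"
  where "semisimple_norm p \<longleftrightarrow>
    jacobson_radical (completion p) = {\<zero>\<^bsub>completion p\<^esub>}"

end

theory Submission imports Defs begin

text \<open>
  A uniform norm makes the algebra commutative: it satisfies $p(xy) = p(yx)$, so the polynomial
  $(1 + za)^n b (1 - za)^n$ is bounded by $p(b)\, p((1 - z^2a^2)^n)$, and Cauchy's estimate on
  $|z| = n^{-1/2}$ for its linear coefficient $n(ab - ba)$ gives $\sqrt n\, p(ab - ba) = O(1)$.

  On a commutative algebra, a minimal uniform seminorm below $p$ with a prescribed value at a point
  is multiplicative, and by Gelfand--Mazur it is the absolute value of a character. Hence $p$ is
  the maximum of $|f|$ over the characters $f$ dominated by $p$. Applied to the quotient norm by a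
  maximal ideal of the completion (after passing to the spectral radius), the same fact shows that
  the characters dominated by a semisimple norm separate points from 0.

  The characters dominated by $q$ form a closed set $K$. If they separate points from 0, as they do
  when $q$ is semisimple or uniform, then weak regularity forces $K$ to contain every character.
  The norm inequalities follow from the description of uniform norms as maxima.
\<close>

text \<open>The algebra need not be complete, so a non-invertible element need not be killed by any
  continuous character: \<open>X - 2\<close> among the polynomials with the supremum norm on the
  unit disc is an example. Spectra and resolvents in the algebra are therefore avoided. Characters
  come from seminorms on the algebra itself, shrunk until they are multiplicative; the value
  prescribed at a point keeps the minimal seminorm from collapsing to 0 and makes the maximum
  attained there. The completion enters only as a ring, and its elements are handled as Cauchy
  sequences. A continuous character is dominated by the norm with constant 1. This turns functional
  continuity into pointwise inequalities, which define closed sets of characters and lead to norm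
  inequalities without a constant. Functional continuity of \<open>p\<close> ensures that the
  characters found below \<open>q\<close> are points of the space to which weak regularity
  applies.\<close>

lemma power_two_power_Suc: "x ^ 2 ^ Suc k = x ^ 2 ^ k * x ^ 2 ^ k" for x :: "'a::monoid_mult"
  by (simp add: power_add[symmetric] mult_2)

section \<open>Algebra seminorms and uniformity\<close>

locale algebra_seminorm = complex_algebra smul
  for smul :: "complex \<Rightarrow> 'a::ring_1 \<Rightarrow> 'a" +
  fixes s :: "'a \<Rightarrow> real"
  assumes seminorm_triangle: "s (x + y) \<le> s x + s y"
    and seminorm_scale: "s (smul c x) = cmod c * s x"
    and seminorm_mult: "s (x * y) \<le> s x * s y"
begin

lemma seminorm_zero [simp]: "s 0 = 0"
  using seminorm_scale[of 0 0] by simp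

lemma seminorm_minus [simp]: "s (- x) = s x"
  using seminorm_scale[of "- 1" x] by simp

lemma seminorm_nonneg [simp]: "0 \<le> s x"
  using seminorm_triangle[of x "- x"] by simp

lemma seminorm_diff: "s (x - y) \<le> s x + s y"
  using seminorm_triangle[of x "- y"] by simp

lemma seminorm_diff_ge: "s x - s y \<le> s (x - y)"
  using seminorm_triangle[of "x - y" y] by simp

lemma seminorm_minus_commute: "s (x - y) = s (y - x)"
  using seminorm_minus[of "x - y"] by simp

lemma seminorm_sum: "s (\<Sum>i\<in>I. g i) \<le> (\<Sum>i\<in>I. s (g i))"
proof (induction I rule: infinite_finite_induct)
  case (insert i I)
  then show ?case using seminorm_triangle[of "g i" "\<Sum>i\<in>I. g i"] by simp
qed auto

text \<open>The factor \<open>z\<close> outside the power makes the bound valid at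
  \<open>n = 0\<close> as well, where \<open>s 1\<close> may exceed 1.\<close>

lemma seminorm_power_mult: "s (x ^ n * z) \<le> s x ^ n * s z"
proof (induction n)
  case (Suc n)
  have "s (x ^ Suc n * z) \<le> s x * s (x ^ n * z)"
    using seminorm_mult[of x "x ^ n * z"] by (simp add: mult.assoc)
  also have "\<dots> \<le> s x * (s x ^ n * s z)"
    by (intro mult_left_mono Suc) simp
  finally show ?case by (simp add: mult.assoc)
qed simp

lemma seminorm_power_Suc: "s (x ^ Suc n) \<le> s x ^ Suc n"
  using seminorm_power_mult[of x n x] by (simp add: power_commutes mult.commute)

lemma seminorm_one_ge:
  assumes "s x > 0"
  shows "1 \<le> s 1"
  using seminorm_mult[of x 1] assms by simp

lemma uniform_seminorm_power:
  assumes u: "uniform_norm s" and x: "s x > 0"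
  shows "s (x ^ n) = s x ^ n"
proof (rule antisym)
  have "s 1 = (s 1)\<^sup>2"
    using u unfolding uniform_norm_def by (metis mult_1)
  with seminorm_one_ge[OF x] have one: "s 1 = 1"
    by (simp add: power2_eq_square)
  show "s (x ^ n) \<le> s x ^ n"
    using seminorm_power_mult[of x n 1] one by simp
  have pow2: "s (x ^ 2 ^ k) = s x ^ 2 ^ k" for k
  proof (induction k)
    case (Suc k)
    show ?case
      unfolding power_two_power_Suc Suc[symmetric]
      using u by (simp add: uniform_norm_def power2_eq_square)
  qed simp
  have n: "n \<le> 2 ^ n" by (simp add: less_imp_le)
  \<comment> \<open>Squaring settles exponents that are powers of two. A general \<open>n\<close> is
    filled up to \<open>2 ^ n\<close>, and the filling is cancelled afterwards.\<close>
  have "s x ^ (2 ^ n - n) * s x ^ n = s x ^ 2 ^ n"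
    using n by (simp add: power_add[symmetric])
  also have "\<dots> = s (x ^ (2 ^ n - n) * x ^ n)"
    using n by (simp add: power_add[symmetric] pow2)
  also have "\<dots> \<le> s x ^ (2 ^ n - n) * s (x ^ n)"
    by (rule seminorm_power_mult)
  finally show "s x ^ n \<le> s (x ^ n)"
    using x by (simp add: mult_le_cancel_left_pos)
qed

lemma uniform_seminorm_one:
  assumes "uniform_norm s" "s x > 0"
  shows "s 1 = 1"
  using uniform_seminorm_power[OF assms, of 0] by simp

text \<open>Powers of \<open>x * y\<close> are powers of \<open>y * x\<close> between the fixed
  factors \<open>x\<close> and \<open>y\<close>, so they cannot grow at a larger exponential rate;
  by uniformity that rate is the seminorm itself.\<close>

lemma uniform_seminorm_swap_le:
  assumes u: "uniform_norm s"
  shows "s (x * y) \<le> s (y * x)"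
proof (rule ccontr)
  assume "\<not> ?thesis"
  then have less: "s (y * x) < s (x * y)" by simp
  then have pos: "s (x * y) > 0" using seminorm_nonneg[of "y * x"] by linarith
  define r where "r = s (y * x) / s (x * y)"
  have r: "0 \<le> r" "r < 1" using less pos by (auto simp: r_def)
  have "s (x * y) \<le> s x * s y * r ^ n" for n
  proof -
    have swap: "(x * y) ^ Suc n = x * ((y * x) ^ n * y)"
      by (induction n) (simp_all add: mult.assoc)
    have "s (x * y) ^ Suc n = s (x * ((y * x) ^ n * y))"
      using uniform_seminorm_power[OF u pos, of "Suc n"] swap by simp
    also have "\<dots> \<le> s x * (s (y * x) ^ n * s y)"
      by (rule order.trans[OF seminorm_mult mult_left_mono[OF seminorm_power_mult]]) simp
    finally show ?thesis using pos by (simp add: r_def field_simps)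
  qed
  moreover have "(\<lambda>n. s x * s y * r ^ n) \<longlonglongrightarrow> s x * s y * 0"
    by (intro tendsto_mult_left LIMSEQ_realpow_zero r)
  ultimately have "s (x * y) \<le> s x * s y * 0"
    by (intro LIMSEQ_le_const) auto
  with pos show False by simp
qed

lemma uniform_seminorm_swap:
  assumes "uniform_norm s"
  shows "s (x * y) = s (y * x)"
  by (intro antisym uniform_seminorm_swap_le assms)

end

sublocale algebra_norm \<subseteq> algebra_seminorm smul p
  by unfold_locales (fact triangle homogeneous submultiplicative)+

section \<open>Commutativity of uniform normed algebras\<close>

lemma root_of_unity_sum_eq_zero:
  fixes k m :: nat
  assumes "0 < k" "k < m"
  shows "(\<Sum>j<m. cis (2 * pi * real k / real m) ^ j) = 0"
proof -
  define w where "w = cis (2 * pi * real k / real m)"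
  have "w \<noteq> 1"
  proof
    assume "w = 1"
    then have "cos (2 * pi * real k / real m) = 1" by (simp add: w_def complex_eq_iff)
    then obtain i :: int where "2 * pi * real k / real m = real_of_int i * 2 * pi"
      by (auto simp: cos_one_2pi_int)
    then have "real k = real_of_int i * real m" using assms by (simp add: field_simps)
    then have "int k = i * int m" by (metis of_int_eq_iff of_int_mult of_int_of_nat_eq)
    then have "m dvd k" by (metis dvd_triv_right int_dvd_int_iff)
    with assms show False by (auto dest: dvd_imp_le)
  qed
  moreover have "w ^ m = 1"
  proof -
    have "real m * (2 * pi * real k / real m) = 2 * pi * real k" using assms by (simp split: if_split)
    then show ?thesis by (simp only: w_def Complex.DeMoivre) (rule cis_multiple_2pi, simp)
  qed
  ultimately show ?thesis
    using geometric_sum[of w m] by (simp add: w_def)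
qed

context algebra_seminorm
begin

text \<open>Cauchy's estimate for the linear coefficient, by averaging over roots of unity.\<close>

lemma linear_coefficient_le:
  assumes \<rho>: "0 \<le> \<rho>"
    and bound: "\<And>z. cmod z = \<rho> \<Longrightarrow> s (\<Sum>k<m. smul (z ^ k) (c k)) \<le> B"
    and m: "1 < m"
  shows "\<rho> * s (c 1) \<le> B"
proof -
  define w where "w j = cis (2 * pi * real j / real m)" for j
  define F where "F z = (\<Sum>k<m. smul (z ^ k) (c k))" for z
  have w_mult: "w (j * k) = w k ^ j" for j k
    by (simp only: w_def Complex.DeMoivre) (rule arg_cong[of _ _ cis], simp add: mult_ac)
  have inv: "w j ^ (m - 1) * w j = 1" for j
  proof -
    have "w j ^ (m - 1) * w j = w j ^ m"
      using m by (metis Suc_diff_1 less_imp_of_nat_less gr_implies_not0 not_gr_zero power_Suc2)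
    moreover have "real m * (2 * pi * real j / real m) = 2 * pi * real j" using m by simp
    ultimately show ?thesis by (simp only: w_def Complex.DeMoivre) (rule cis_multiple_2pi, simp)
  qed
  \<comment> \<open>The weight \<open>w j ^ (m - 1)\<close> is the inverse of \<open>w j\<close>; it
    plays the part of the kernel that extracts the first coefficient in Cauchy's integral.\<close>
  have avg: "(\<Sum>j<m. w j ^ (m - 1) * (of_real \<rho> * w j) ^ k) = (if k = 1 then of_real (m * \<rho>) else 0)"
    if "k < m" for k
  proof (cases "k = 1")
    case True
    then show ?thesis using inv by (simp add: mult.left_commute[of _ "of_real \<rho>"])
  next
    case False
    \<comment> \<open>This is \<open>k - 1\<close> modulo \<open>m\<close>, with
      \<open>k = 0\<close> wrapping around to \<open>m - 1\<close>; it is nonzero because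
      \<open>k\<close> is not 1.\<close>
    define l where "l = (if k = 0 then m - 1 else k - 1)"
    have l: "0 < l" "l < m" using False m that by (auto simp: l_def)
    have "w j ^ (m - 1) * w j ^ k = w l ^ j" for j
    proof -
      have "w j ^ (m - 1) * w j ^ k = w j ^ l"
      proof (cases "k = 0")
        case False
        then have "w j ^ k = w j * w j ^ (k - 1)" by (simp add: power_eq_if)
        then show ?thesis using inv[of j] False by (simp add: l_def mult.assoc[symmetric])
      qed (simp add: l_def)
      then show ?thesis using w_mult[of l j] w_mult[of j l] by (simp add: mult.commute)
    qed
    then have "(\<Sum>j<m. w j ^ (m - 1) * (of_real \<rho> * w j) ^ k) = of_real \<rho> ^ k * (\<Sum>j<m. w l ^ j)"
      by (simp add: power_mult_distrib sum_distrib_left mult_ac)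
    also have "\<dots> = 0"
      using root_of_unity_sum_eq_zero[OF l] by (simp add: w_def)
    finally show ?thesis using False by simp
  qed
  have "(\<Sum>j<m. smul (w j ^ (m - 1)) (F (of_real \<rho> * w j)))
      = (\<Sum>k<m. smul (\<Sum>j<m. w j ^ (m - 1) * (of_real \<rho> * w j) ^ k) (c k))"
    unfolding F_def scale_sum_left scale_sum_right scale_scale
    by (rule sum.swap)
  also have "\<dots> = (\<Sum>k<m. if k = 1 then smul (of_real (m * \<rho>)) (c k) else 0)"
    by (intro sum.cong refl) (simp only: avg lessThan_iff, simp)
  also have "\<dots> = smul (of_real (m * \<rho>)) (c 1)"
    using m by simp
  finally have "s (smul (of_real (m * \<rho>)) (c 1))
      \<le> (\<Sum>j<m. s (smul (w j ^ (m - 1)) (F (of_real \<rho> * w j))))"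
    using seminorm_sum by metis
  also have "\<dots> \<le> (\<Sum>j<m. B)"
    using \<rho> by (intro sum_mono)
      (simp add: seminorm_scale norm_power w_def F_def bound norm_mult)
  finally show ?thesis
    using \<rho> m by (simp add: seminorm_scale norm_mult mult.assoc)
qed

text \<open>The clause on \<open>c 0\<close> carries the induction: one more pair of factors adds
  \<open>a * c 0 - c 0 * a\<close> to the linear coefficient and leaves the constant one
  alone.\<close>

lemma conjugation_polynomial:
  "\<exists>m c. 1 < m \<and> c 1 = smul (of_nat n) (a * b - b * a) \<and> c 0 = b \<and>
    (\<forall>z. (1 + smul z a) ^ n * b * (1 - smul z a) ^ n = (\<Sum>k<m. smul (z ^ k) (c k)))"
proof (induction n)
  case 0
  show ?case
    by (rule exI[of _ 2], rule exI[of _ "\<lambda>k. if k = 0 then b else 0"]) (simp add: numeral_2_eq_2)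
next
  case (Suc n)
  then obtain m c where IH: "1 < m" "c 1 = smul (of_nat n) (a * b - b * a)" "c 0 = b"
    "\<And>z. (1 + smul z a) ^ n * b * (1 - smul z a) ^ n = (\<Sum>k<m. smul (z ^ k) (c k))"
    by metis
  \<comment> \<open>Nothing is known of \<open>c\<close> from \<open>m\<close> on, so it is cut off
    there. The sequences \<open>c1\<close> and \<open>c2\<close> collect what is shifted by one and
    by two degrees.\<close>
  define c0 where "c0 k = (if k < m then c k else 0)" for k
  define c1 where "c1 k = (case k of 0 \<Rightarrow> 0 | Suc i \<Rightarrow> a * c0 i - c0 i * a)" for k
  define c2 where "c2 k = (case k of 0 \<Rightarrow> 0 | Suc 0 \<Rightarrow> 0 | Suc (Suc i) \<Rightarrow> a * c0 i * a)" for k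
  define e where "e k = c0 k + c1 k - c2 k" for k
  have eq: "(1 + smul z a) ^ Suc n * b * (1 - smul z a) ^ Suc n
    = (\<Sum>k<Suc (Suc m). smul (z ^ k) (e k))" for z
  proof -
    define P where "P = (\<Sum>k<m. smul (z ^ k) (c k))"
    have P: "P = (\<Sum>k<m. smul (z ^ k) (c0 k))"
      by (simp add: P_def c0_def)
    have "(1 + smul z a) ^ Suc n * b * (1 - smul z a) ^ Suc n
      = (1 + smul z a) * ((1 + smul z a) ^ n * b * (1 - smul z a) ^ n) * (1 - smul z a)"
      by (simp only: power_Suc power_commutes mult.assoc)
    also have "\<dots> = P + smul z (a * P - P * a) - smul (z * z) (a * P * a)"
      unfolding IH(4) P_def[symmetric]
      by (simp add: algebra_simps smul_mult_left smul_mult_right scale_right_diff_distrib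
          scale_right_distrib)
    also have "smul z (a * P - P * a) = (\<Sum>k<Suc m. smul (z ^ Suc k) (a * c0 k - c0 k * a))"
      unfolding P by (simp add: c0_def sum_distrib_left sum_distrib_right smul_mult_left
          smul_mult_right scale_sum_right sum_subtractf scale_right_diff_distrib)
    also have "\<dots> = (\<Sum>k<Suc (Suc m). smul (z ^ k) (c1 k))"
      unfolding sum.lessThan_Suc_shift[of _ "Suc m"] by (simp add: c1_def del: sum.lessThan_Suc)
    also have "smul (z * z) (a * P * a) = (\<Sum>k<Suc (Suc m). smul (z ^ k) (c2 k))"
      unfolding P sum.lessThan_Suc_shift
      by (simp add: c2_def sum_distrib_left sum_distrib_right smul_mult_left
          smul_mult_right scale_sum_right mult_ac)
    also have "P = (\<Sum>k<Suc (Suc m). smul (z ^ k) (c0 k))"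
      unfolding P by (simp add: c0_def)
    finally show ?thesis
      by (simp only: e_def scale_right_distrib scale_right_diff_distrib sum.distrib sum_subtractf)
  qed
  have "e 1 = smul (of_nat (Suc n)) (a * b - b * a)" "e 0 = b"
    using IH by (auto simp: e_def c0_def c1_def c2_def scale_left_distrib)
  then show ?case
    using eq by (intro exI[of _ "Suc (Suc m)"] exI[of _ e]) auto
qed

lemma uniform_commutator:
  assumes u: "uniform_norm s"
  shows "s (a * b - b * a) = 0"
proof (rule ccontr)
  define D where "D = s (a * b - b * a)"
  assume "s (a * b - b * a) \<noteq> 0"
  then have D: "D > 0" by (simp add: D_def less_le)
  have one: "s 1 = 1" using uniform_seminorm_one[OF u] D by (simp add: D_def)
  define B where "B = s b * exp ((s a)\<^sup>2)"
  have "sqrt n * D \<le> B" if n: "n > 0" for n :: nat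
  proof -
    \<comment> \<open>The radius balances two effects: \<open>Y * X\<close> below differs from 1
      only by a term of size \<open>\<rho> * \<rho> = 1 / n\<close>, so its \<open>n\<close>-th
      power stays bounded, while the linear term still has size
      \<open>\<rho> * n = sqrt n\<close>.\<close>
    define \<rho> where "\<rho> = 1 / sqrt n"
    obtain m c where c: "1 < m" "c 1 = smul (of_nat n) (a * b - b * a)"
      "\<And>z. (1 + smul z a) ^ n * b * (1 - smul z a) ^ n = (\<Sum>k<m. smul (z ^ k) (c k))"
      using conjugation_polynomial[of n a b] by metis
    have "s (\<Sum>k<m. smul (z ^ k) (c k)) \<le> B" if z: "cmod z = \<rho>" for z
    proof -
      define X where "X = 1 + smul z a"
      define Y where "Y = 1 - smul z a"
      have XY: "Y * X = X * Y" by (simp add: X_def Y_def algebra_simps)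
      have YX: "Y ^ k * X ^ k = (Y * X) ^ k" for k
      proof (induction k)
        case (Suc k)
        have "Y ^ Suc k * X ^ Suc k = Y * (Y ^ k * X) * X ^ k" by (simp add: mult.assoc)
        also have "\<dots> = (Y * X) * (Y ^ k * X ^ k)"
          using power_commuting_commutes[OF XY, of k] by (simp add: mult.assoc)
        finally show ?case by (simp add: Suc)
      qed simp
      have "s (\<Sum>k<m. smul (z ^ k) (c k)) = s (X ^ n * b * Y ^ n)"
        by (simp add: c X_def Y_def)
      also have "\<dots> = s ((Y ^ n * X ^ n) * b)"
        using uniform_seminorm_swap[OF u, of "X ^ n * b" "Y ^ n"] by (simp add: mult.assoc)
      also have "\<dots> \<le> s (Y * X) ^ n * s b"
        unfolding YX by (rule seminorm_power_mult)
      also have "s (Y * X) \<le> exp ((s a)\<^sup>2 / n)"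
      proof -
        have "Y * X = 1 - smul (z * z) (a * a)"
          by (simp add: X_def Y_def algebra_simps smul_mult_left smul_mult_right)
        then have "s (Y * X) \<le> 1 + \<rho> * \<rho> * s (a * a)"
          using seminorm_diff[of 1 "smul (z * z) (a * a)"] one z
          by (simp add: seminorm_scale norm_mult)
        also have "\<dots> = 1 + (s a)\<^sup>2 / n"
          using u n by (simp add: \<rho>_def uniform_norm_def)
        also have "\<dots> \<le> exp ((s a)\<^sup>2 / n)" by (rule exp_ge_add_one_self)
        finally show ?thesis .
      qed
      then have "s (Y * X) ^ n * s b \<le> exp ((s a)\<^sup>2 / n) ^ n * s b"
        by (intro mult_right_mono power_mono) auto
      also have "\<dots> = B" using n by (simp add: B_def exp_of_nat_mult[symmetric])
      finally show ?thesis .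
    qed
    then have "\<rho> * s (c 1) \<le> B"
      by (intro linear_coefficient_le[where m = m] c(1)) (auto simp: \<rho>_def)
    moreover have "\<rho> * real n = sqrt n" using real_div_sqrt[of "real n"] by (simp add: \<rho>_def)
    then have "\<rho> * s (c 1) = sqrt n * D"
      unfolding c(2) by (simp add: seminorm_scale D_def mult.assoc[symmetric])
    ultimately show ?thesis by simp
  qed
  moreover obtain n :: nat where "real n > (B / D)\<^sup>2 + 1"
    using reals_Archimedean2 by blast
  then have "real n > 0" "sqrt n > B / D"
    using zero_le_power2[of "B / D"] real_less_rsqrt[of "B / D" "real n"] by linarith+
  ultimately show False
    using D by (metis not_le of_nat_0_less_iff pos_divide_less_eq)
qed

end

lemma (in algebra_norm) uniform_norm_commute:
  fixes x y :: 'a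
  assumes "uniform_norm p"
  shows "x * y = y * x"
  using uniform_commutator[OF assms, of x y] eq_zero_iff by simp

subsection \<open>The spectral radius\<close>

text \<open>Commutativity is a locale assumption rather than a type class because it is derived from
  the existence of a uniform norm on a type that is only a \<open>ring_1\<close>.\<close>

locale commutative_algebra_seminorm = algebra_seminorm smul s
  for smul :: "complex \<Rightarrow> 'a::ring_1 \<Rightarrow> 'a" and s +
  assumes mult_commute: "(x :: 'a) * y = y * x"
begin

lemma commutative_power_mult: "(x * y :: 'a) ^ n = x ^ n * y ^ n"
proof (induction n)
  case (Suc n)
  have "(x * y) ^ Suc n = x * (y * x ^ n) * y ^ n" 
    by (subst mult_commute[of y]) (simp add: Suc mult.assoc, metis mult.assoc mult_commute)
  also have "\<dots> = x ^ Suc n * y ^ Suc n"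
    by (subst mult_commute[of y]) (simp add: mult.assoc)
  finally show ?case .
qed simp

lemma commutative_mult_middle: "(a * b) * (c * d :: 'a) = (a * c) * (b * d)"
  by (metis mult.assoc mult_commute)

lemma commutative_algebra_seminormI:
  assumes "\<And>x y. t (x + y) \<le> t x + t y" "\<And>c x. t (smul c x) = cmod c * t x"
    "\<And>x y. t (x * y) \<le> t x * t y"
  shows "commutative_algebra_seminorm smul t"
proof
  show "t (x + y) \<le> t x + t y" for x y by (rule assms(1))
  show "t (smul c x) = cmod c * t x" for c x by (rule assms(2))
  show "t (x * y) \<le> t x * t y" for x y by (rule assms(3))
  show "(x :: 'a) * y = y * x" for x y by (rule mult_commute)
qed

text \<open>Division of \<open>i\<close> by \<open>m\<close> with remainder: the quotient is
  controlled by the hypothesis, and \<open>C\<close> absorbs the finitely many remainders.\<close>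

lemma power_growth:
  assumes \<alpha>: "0 < \<alpha>" and m: "0 < m" "s (x ^ m) \<le> \<alpha> ^ m"
  obtains C where "0 \<le> C" "\<And>i. s (x ^ i) \<le> C * \<alpha> ^ i"
proof
  define C where "C = (\<Sum>r<m. s (x ^ r) / \<alpha> ^ r)"
  show "0 \<le> C" unfolding C_def using \<alpha> by (intro sum_nonneg) auto
  show "s (x ^ i) \<le> C * \<alpha> ^ i" for i
  proof -
    define k r where "k = i div m" and "r = i mod m"
    have i: "i = m * k + r" and r: "r < m" using m by (auto simp: k_def r_def)
    have "s (x ^ i) \<le> s (x ^ m) ^ k * s (x ^ r)"
      unfolding i power_add power_mult by (rule seminorm_power_mult)
    also have "\<dots> \<le> (\<alpha> ^ m) ^ k * s (x ^ r)"
      using m by (intro mult_right_mono power_mono) auto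
    also have "\<dots> = \<alpha> ^ i * (s (x ^ r) / \<alpha> ^ r)"
      using \<alpha> by (simp add: i power_add power_mult)
    also have "s (x ^ r) / \<alpha> ^ r \<le> C"
      unfolding C_def using r \<alpha> by (intro member_le_sum) auto
    then have "\<alpha> ^ i * (s (x ^ r) / \<alpha> ^ r) \<le> C * \<alpha> ^ i"
      using \<alpha> by (simp only: mult.commute[of C]) (intro mult_left_mono, auto)
    finally show ?thesis .
  qed
qed

text \<open>Generalising over the factor \<^term>\<open>x ^ i * y ^ j\<close> makes the binomial theorem unnecessary.\<close>

lemma power_growth_add:
  assumes x: "\<And>i. s (x ^ i) \<le> C * \<alpha> ^ i" and y: "\<And>j. s (y ^ j) \<le> D * \<beta> ^ j"
    and nonneg: "0 \<le> C" "0 \<le> D" "0 \<le> \<alpha>" "0 \<le> \<beta>"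
  shows "s ((x + y) ^ n * (x ^ i * y ^ j)) \<le> C * D * (\<alpha> ^ i * \<beta> ^ j) * (\<alpha> + \<beta>) ^ n"
proof (induction n arbitrary: i j)
  case 0
  have "s (x ^ i * y ^ j) \<le> (C * \<alpha> ^ i) * (D * \<beta> ^ j)"
    using nonneg by (intro order.trans[OF seminorm_mult] mult_mono x y) auto
  then show ?case by (simp add: mult_ac)
next
  case (Suc n)
  have "(x + y) ^ Suc n * (x ^ i * y ^ j)
      = (x + y) ^ n * (x ^ Suc i * y ^ j) + (x + y) ^ n * (x ^ i * y ^ Suc j)"
    by (simp only: power_Suc2 mult.assoc distrib_left distrib_right power_Suc mult_commute[of y])
      (simp only: mult.assoc[symmetric] power_commutes)
  then have "s ((x + y) ^ Suc n * (x ^ i * y ^ j))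
      \<le> s ((x + y) ^ n * (x ^ Suc i * y ^ j)) + s ((x + y) ^ n * (x ^ i * y ^ Suc j))"
    by (metis seminorm_triangle)
  also have "\<dots> \<le> C * D * (\<alpha> ^ Suc i * \<beta> ^ j) * (\<alpha> + \<beta>) ^ n
      + C * D * (\<alpha> ^ i * \<beta> ^ Suc j) * (\<alpha> + \<beta>) ^ n"
    by (intro add_mono Suc)
  also have "\<dots> = C * D * (\<alpha> ^ i * \<beta> ^ j) * (\<alpha> + \<beta>) ^ Suc n"
    by (simp add: algebra_simps)
  finally show ?case .
qed

text \<open>Gelfand's formula for the spectral radius, along powers of two only: the sequence is
  then decreasing, and squaring the argument just shifts the index, which makes the limit
  uniform.\<close>

definition spectral_approx :: "nat \<Rightarrow> 'a \<Rightarrow> real"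
  where "spectral_approx k x = root (2 ^ k) (s (x ^ 2 ^ k))"

definition spectral_seminorm :: "'a \<Rightarrow> real"
  where "spectral_seminorm x = lim (\<lambda>k. spectral_approx k x)"

lemma spectral_approx_nonneg [simp]: "0 \<le> spectral_approx k x"
  by (simp add: spectral_approx_def)

lemma spectral_approx_Suc_le: "spectral_approx (Suc k) x \<le> spectral_approx k x"
proof -
  have "s (x ^ 2 ^ Suc k) \<le> (s (x ^ 2 ^ k))\<^sup>2"
    unfolding power_two_power_Suc power2_eq_square by (rule seminorm_mult)
  then have "root (2 ^ k) (root 2 (s (x ^ 2 ^ Suc k))) \<le> root (2 ^ k) (root 2 ((s (x ^ 2 ^ k))\<^sup>2))"
    by (simp del: power_Suc)
  moreover have "spectral_approx (Suc k) x = root (2 ^ k) (root 2 (s (x ^ 2 ^ Suc k)))"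
    by (simp only: spectral_approx_def power_Suc2[of 2] real_root_mult_exp)
  ultimately show ?thesis by (simp add: spectral_approx_def real_root_power_cancel)
qed

lemma spectral_approx_tendsto: "(\<lambda>k. spectral_approx k x) \<longlonglongrightarrow> spectral_seminorm x"
proof -
  have "decseq (\<lambda>k. spectral_approx k x)"
    by (simp add: decseq_Suc_iff spectral_approx_Suc_le)
  then have "convergent (\<lambda>k. spectral_approx k x)"
    using decseq_convergent[of "\<lambda>k. spectral_approx k x" 0] by (auto simp: convergent_def)
  then show ?thesis by (simp add: spectral_seminorm_def convergent_LIMSEQ_iff)
qed

lemma spectral_seminorm_le_approx: "spectral_seminorm x \<le> spectral_approx k x"
  by (rule decseq_ge[OF _ spectral_approx_tendsto]) (simp add: decseq_Suc_iff spectral_approx_Suc_le)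

lemma spectral_seminorm_le: "spectral_seminorm x \<le> s x"
  using spectral_seminorm_le_approx[of x 0] by (simp add: spectral_approx_def)

lemma spectral_seminorm_nonneg: "0 \<le> spectral_seminorm x"
  by (rule LIMSEQ_le_const[OF spectral_approx_tendsto]) auto

lemma spectral_seminorm_one:
  assumes "1 \<le> s 1"
  shows "1 \<le> spectral_seminorm 1"
  by (rule LIMSEQ_le_const[OF spectral_approx_tendsto]) (use assms in \<open>auto simp: spectral_approx_def\<close>)

text \<open>A bound at a single exponent \<open>2 ^ k\<close> spreads to all exponents. The triangle
  inequality needs them all, since the expansion of a power of \<open>x + y\<close> contains every
  mixed power.\<close>

lemma spectral_seminorm_growth:
  assumes "spectral_seminorm x < \<alpha>"
  obtains C where "0 \<le> C" "\<And>i. s (x ^ i) \<le> C * \<alpha> ^ i"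
proof -
  have \<alpha>: "0 < \<alpha>" using assms spectral_seminorm_nonneg[of x] by linarith
  have "\<forall>\<^sub>F k in sequentially. spectral_approx k x < \<alpha>"
    using order_tendstoD(2)[OF spectral_approx_tendsto assms] .
  then obtain k where "spectral_approx k x < \<alpha>"
    by (metis eventually_at_top_linorder order_refl)
  then have "spectral_approx k x ^ 2 ^ k \<le> \<alpha> ^ 2 ^ k"
    by (intro power_mono) auto
  then have "s (x ^ 2 ^ k) \<le> \<alpha> ^ 2 ^ k" by (simp add: spectral_approx_def)
  then show ?thesis by (rule power_growth[OF \<alpha>, rotated]) (rule that, assumption+, simp)
qed

lemma spectral_seminorm_triangle:
  "spectral_seminorm (x + y) \<le> spectral_seminorm x + spectral_seminorm y"
proof -
  have le: "spectral_seminorm (x + y) \<le> \<alpha> + \<beta>"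
    if \<alpha>: "spectral_seminorm x < \<alpha>" and \<beta>: "spectral_seminorm y < \<beta>" for \<alpha> \<beta>
  proof -
    have pos: "0 < \<alpha>" "0 < \<beta>"
      using \<alpha> \<beta> spectral_seminorm_nonneg[of x] spectral_seminorm_nonneg[of y] by linarith+
    obtain C where C: "0 \<le> C" "\<And>i. s (x ^ i) \<le> C * \<alpha> ^ i"
      using spectral_seminorm_growth[OF \<alpha>] by blast
    obtain D where D: "0 \<le> D" "\<And>i. s (y ^ i) \<le> D * \<beta> ^ i"
      using spectral_seminorm_growth[OF \<beta>] by blast
    have approx: "spectral_approx k (x + y) \<le> root (2 ^ k) (C * D + 1) * (\<alpha> + \<beta>)" for k
    proof -
      have "s ((x + y) ^ 2 ^ k) \<le> C * D * (\<alpha> + \<beta>) ^ 2 ^ k"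
        using power_growth_add[OF C(2) D(2) C(1) D(1), where n = "2 ^ k" and i = 0 and j = 0] pos
        by simp
      \<comment> \<open>Adding 1 makes the constant positive, so that its roots tend to 1 even if
        \<open>C * D = 0\<close>.\<close>
      also have "\<dots> \<le> (C * D + 1) * (\<alpha> + \<beta>) ^ 2 ^ k"
        using pos by (intro mult_right_mono) auto
      finally have "spectral_approx k (x + y) \<le> root (2 ^ k) ((C * D + 1) * (\<alpha> + \<beta>) ^ 2 ^ k)"
        by (simp add: spectral_approx_def)
      then show ?thesis using pos by (simp add: real_root_mult real_root_power_cancel)
    qed
    have "0 < C * D + 1" using C D by (simp add: add_nonneg_pos)
    then have "(\<lambda>n. root n (C * D + 1)) \<longlonglongrightarrow> 1" by (rule LIMSEQ_root_const)
    moreover have "strict_mono (\<lambda>k::nat. 2 ^ k :: nat)" by (simp add: strict_mono_def)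
    ultimately have "(\<lambda>k. root (2 ^ k) (C * D + 1)) \<longlonglongrightarrow> 1"
      using LIMSEQ_subseq_LIMSEQ[of "\<lambda>n. root n (C * D + 1)" 1 "\<lambda>k. 2 ^ k"] by (simp add: o_def)
    then have "(\<lambda>k. root (2 ^ k) (C * D + 1) * (\<alpha> + \<beta>)) \<longlonglongrightarrow> 1 * (\<alpha> + \<beta>)"
      by (rule tendsto_mult_right)
    then show ?thesis
      using LIMSEQ_le[OF spectral_approx_tendsto] approx by fastforce
  qed
  show ?thesis
  proof (rule field_le_epsilon)
    fix e :: real assume "0 < e"
    then show "spectral_seminorm (x + y) \<le> spectral_seminorm x + spectral_seminorm y + e"
      using le[of "spectral_seminorm x + e / 2" "spectral_seminorm y + e / 2"] by simp
  qed
qed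

lemma power_scale: "smul c x ^ n = smul (c ^ n) (x ^ n)"
  by (induction n) (simp_all add: smul_mult_left smul_mult_right mult.commute)

lemma spectral_seminorm_algebra_seminorm:
  "commutative_algebra_seminorm smul spectral_seminorm"
proof (rule commutative_algebra_seminormI)
  show "spectral_seminorm (smul c x) = cmod c * spectral_seminorm x" for c x
  proof (rule LIMSEQ_unique[OF spectral_approx_tendsto])
    have "spectral_approx k (smul c x) = cmod c * spectral_approx k x" for k
      by (simp add: spectral_approx_def power_scale seminorm_scale norm_power real_root_mult
          real_root_power_cancel)
    then show "(\<lambda>k. spectral_approx k (smul c x)) \<longlonglongrightarrow> cmod c * spectral_seminorm x"
      by (simp add: spectral_approx_tendsto tendsto_mult_left)
  qed
  show "spectral_seminorm (x * y) \<le> spectral_seminorm x * spectral_seminorm y" for x y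
  proof (rule LIMSEQ_le[OF spectral_approx_tendsto tendsto_mult[OF spectral_approx_tendsto
        spectral_approx_tendsto]])
    have "spectral_approx k (x * y) \<le> spectral_approx k x * spectral_approx k y" for k
      using seminorm_mult
      by (simp add: spectral_approx_def commutative_power_mult real_root_mult[symmetric])
    then show "\<exists>N. \<forall>k\<ge>N. spectral_approx k (x * y) \<le> spectral_approx k x * spectral_approx k y"
      by blast
  qed
qed (rule spectral_seminorm_triangle)

lemma spectral_seminorm_uniform: "uniform_norm spectral_seminorm"
  unfolding uniform_norm_def
proof
  fix x
  have sq: "spectral_approx k (x * x) = (spectral_approx (Suc k) x)\<^sup>2" for k
  proof -
    have "(x * x) ^ 2 ^ k = x ^ 2 ^ Suc k"
      by (simp add: power_mult power2_eq_square)
    then show ?thesis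
      by (simp add: spectral_approx_def real_root_mult_exp)
  qed
  have "(\<lambda>k. (spectral_approx (Suc k) x)\<^sup>2) \<longlonglongrightarrow> (spectral_seminorm x)\<^sup>2"
    by (intro tendsto_power LIMSEQ_Suc spectral_approx_tendsto)
  then show "spectral_seminorm (x * x) = (spectral_seminorm x)\<^sup>2"
    using LIMSEQ_unique[OF spectral_approx_tendsto] by (simp add: sq[symmetric])
qed

end

subsection \<open>Minimal uniform seminorms\<close>

text \<open>Lets \<open>e\<close> tend to 0 in estimates whose error is not simply added, such as
  \<open>(u x + e) * (u y + e)\<close>.\<close>

lemma le_at_zeroI:
  fixes g :: "real \<Rightarrow> real"
  assumes "continuous (at_right 0) g" "\<And>e. 0 < e \<Longrightarrow> a \<le> g e"
  shows "a \<le> g 0"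
  using assms by (intro tendsto_lowerbound[of g "g 0" "at_right 0"])
    (auto simp: continuous_within eventually_at_right_less intro: eventually_at_rightI[of 0 1])

context commutative_algebra_seminorm
begin

text \<open>Known as smoothing in non-archimedean analysis. For \<open>s y > 0\<close> the values
  decrease in \<open>n\<close>, and their limit is a smaller seminorm for which multiplication by
  \<open>y\<close> scales exactly by \<open>s y\<close>.\<close>

definition orbit_approx :: "'a \<Rightarrow> nat \<Rightarrow> 'a \<Rightarrow> real"
  where "orbit_approx y n x = s (x * y ^ n) / s y ^ n"

definition orbit_seminorm :: "'a \<Rightarrow> 'a \<Rightarrow> real"
  where "orbit_seminorm y x = lim (\<lambda>n. orbit_approx y n x)"

lemma orbit_approx_nonneg: "0 \<le> orbit_approx y n x"
  by (simp add: orbit_approx_def)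

lemma orbit_approx_Suc_le:
  assumes "0 < s y"
  shows "orbit_approx y (Suc n) x \<le> orbit_approx y n x"
proof -
  have "s (x * y ^ Suc n) \<le> s (x * y ^ n) * s y"
    using seminorm_mult[of "x * y ^ n" y] by (simp add: power_commutes mult.assoc)
  then show ?thesis
    using assms by (simp add: orbit_approx_def field_simps)
qed

lemma orbit_approx_tendsto:
  assumes "0 < s y"
  shows "(\<lambda>n. orbit_approx y n x) \<longlonglongrightarrow> orbit_seminorm y x"
proof -
  have "decseq (\<lambda>n. orbit_approx y n x)"
    by (simp add: decseq_Suc_iff orbit_approx_Suc_le assms)
  then have "convergent (\<lambda>n. orbit_approx y n x)"
    by (metis convergentI decseq_convergent orbit_approx_nonneg)
  then show ?thesis by (simp add: orbit_seminorm_def convergent_LIMSEQ_iff)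
qed

lemma orbit_approx_double_tendsto:
  assumes "0 < s y"
  shows "(\<lambda>n. orbit_approx y (2 * n) x) \<longlonglongrightarrow> orbit_seminorm y x"
  using LIMSEQ_subseq_LIMSEQ[OF orbit_approx_tendsto[OF assms], of "\<lambda>n. 2 * n"]
  by (simp add: strict_mono_def o_def)

lemma orbit_seminorm_le:
  assumes "0 < s y"
  shows "orbit_seminorm y x \<le> s x"
  using decseq_ge[OF _ orbit_approx_tendsto[OF assms], of x 0] assms
  by (simp add: decseq_Suc_iff orbit_approx_Suc_le) (simp add: orbit_approx_def)

text \<open>Distributes \<open>2 * n\<close> copies of \<open>y\<close> evenly over two factors;
  submultiplicativity and uniformity of the limit are therefore read off along even indices.\<close>

lemma orbit_power_double: "(a * b) * y ^ (2 * n) = (a * y ^ n) * (b * y ^ n)"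
  for a b y :: 'a
  by (simp only: mult_2 power_add commutative_mult_middle[of a b])

lemma orbit_seminorm_algebra_seminorm:
  assumes y: "0 < s y"
  shows "commutative_algebra_seminorm smul (orbit_seminorm y)"
proof (rule commutative_algebra_seminormI)
  fix a b c
  have "orbit_approx y n (a + b) \<le> orbit_approx y n a + orbit_approx y n b" for n
    using y seminorm_triangle[of "a * y ^ n" "b * y ^ n"]
    by (simp add: orbit_approx_def distrib_right divide_right_mono flip: add_divide_distrib)
  then show "orbit_seminorm y (a + b) \<le> orbit_seminorm y a + orbit_seminorm y b"
    by (intro LIMSEQ_le[OF orbit_approx_tendsto[OF y]
          tendsto_add[OF orbit_approx_tendsto[OF y] orbit_approx_tendsto[OF y]]]) auto
  have "orbit_approx y n (smul c a) = cmod c * orbit_approx y n a" for n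
    by (simp add: orbit_approx_def smul_mult_left seminorm_scale)
  then show "orbit_seminorm y (smul c a) = cmod c * orbit_seminorm y a"
    by (intro LIMSEQ_unique[OF orbit_approx_tendsto[OF y]])
      (simp add: orbit_approx_tendsto[OF y] tendsto_mult_left)
  have "orbit_approx y (2 * n) (a * b) \<le> orbit_approx y n a * orbit_approx y n b" for n
  proof -
    have "orbit_approx y n a * orbit_approx y n b = s (a * y ^ n) * s (b * y ^ n) / s y ^ (2 * n)"
      by (simp only: orbit_approx_def mult_2 power_add times_divide_times_eq)
    then show ?thesis
      unfolding orbit_approx_def orbit_power_double
      using y by (simp only:) (intro divide_right_mono seminorm_mult, simp)
  qed
  then show "orbit_seminorm y (a * b) \<le> orbit_seminorm y a * orbit_seminorm y b"
    by (intro LIMSEQ_le[OF orbit_approx_double_tendsto[OF y]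
          tendsto_mult[OF orbit_approx_tendsto[OF y] orbit_approx_tendsto[OF y]]]) auto
qed

lemma orbit_seminorm_uniform:
  assumes u: "uniform_norm s" and y: "0 < s y"
  shows "uniform_norm (orbit_seminorm y)"
  unfolding uniform_norm_def
proof
  fix x
  have "orbit_approx y (2 * n) (x * x) = (orbit_approx y n x)\<^sup>2" for n
    unfolding orbit_approx_def orbit_power_double using u
    by (simp add: uniform_norm_def power_divide power_mult[symmetric] mult.commute)
  then show "orbit_seminorm y (x * x) = (orbit_seminorm y x)\<^sup>2"
    by (intro LIMSEQ_unique[OF orbit_approx_double_tendsto[OF y]])
      (simp add: orbit_approx_tendsto[OF y] tendsto_power)
qed

text \<open>Multiplying \<open>x\<close> by \<open>y\<close> only shifts the index, at the price of
  one factor \<open>s y\<close>, and the limit does not see the shift. This is the purpose of the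
  construction.\<close>

lemma orbit_seminorm_mult_self:
  assumes y: "0 < s y"
  shows "orbit_seminorm y (x * y) = orbit_seminorm y x * s y"
proof (rule LIMSEQ_unique[OF orbit_approx_tendsto[OF y]])
  have "orbit_approx y n (x * y) = orbit_approx y (Suc n) x * s y" for n
    using y by (simp add: orbit_approx_def mult.assoc)
  then show "(\<lambda>n. orbit_approx y n (x * y)) \<longlonglongrightarrow> orbit_seminorm y x * s y"
    by (simp only:) (intro tendsto_mult_right LIMSEQ_Suc orbit_approx_tendsto y)
qed

text \<open>Keeps the prescribed value at a point \<open>x\<close> that is already multiplicative
  when the smoothing is done at another point \<open>y\<close>.\<close>

lemma orbit_seminorm_eq:
  assumes u: "uniform_norm s" and y: "0 < s y" and x: "\<And>z. s (x * z) = s x * s z"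
  shows "orbit_seminorm y x = s x"
proof (rule LIMSEQ_unique[OF orbit_approx_tendsto[OF y]])
  show "(\<lambda>n. orbit_approx y n x) \<longlonglongrightarrow> s x"
    using y by (simp add: orbit_approx_def x uniform_seminorm_power[OF u y])
qed

text \<open>Smoothing at \<open>y\<close> itself does not lower the value there, because uniformity
  makes the powers of \<open>y\<close> multiplicative.\<close>

lemma orbit_seminorm_self:
  assumes u: "uniform_norm s" and y: "0 < s y"
  shows "orbit_seminorm y y = s y"
proof (rule LIMSEQ_unique[OF orbit_approx_tendsto[OF y]])
  have "orbit_approx y n y = s y" for n
    using uniform_seminorm_power[OF u y, of "Suc n"] y by (simp add: orbit_approx_def)
  then show "(\<lambda>n. orbit_approx y n y) \<longlonglongrightarrow> s y" by simp
qed

text \<open>Provides the lower bounds for Zorn's lemma. Infima of seminorms are not subadditive in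
  general; in a chain, one member comes close to the infimum at two given points simultaneously, and
  its inequalities pass to the limit.\<close>

lemma chain_infimum:
  assumes C: "C \<noteq> {}"
    and seminorms: "\<And>t. t \<in> C \<Longrightarrow> commutative_algebra_seminorm smul t \<and> uniform_norm t"
    and chain: "\<And>t t'. t \<in> C \<Longrightarrow> t' \<in> C \<Longrightarrow> t \<le> t' \<or> t' \<le> t"
  defines "u \<equiv> \<lambda>x. INF t\<in>C. t x"
  shows "commutative_algebra_seminorm smul u" "uniform_norm u" "\<And>t. t \<in> C \<Longrightarrow> u \<le> t"
proof -
  have nonneg: "0 \<le> t x" if "t \<in> C" for t x
    using algebra_seminorm.seminorm_nonneg seminorms[OF that]
    by (auto simp: commutative_algebra_seminorm_def)
  then have bdd: "bdd_below ((\<lambda>t. t x) ` C)" for x by (intro bdd_belowI[of _ 0]) auto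
  have lower: "u x \<le> t x" if "t \<in> C" for t x
    unfolding u_def by (rule cINF_lower[OF bdd that])
  then show "\<And>t. t \<in> C \<Longrightarrow> u \<le> t" by (simp add: le_fun_def)
  have greatest: "r \<le> u x" if "\<And>t. t \<in> C \<Longrightarrow> r \<le> t x" for r x
    unfolding u_def by (rule cINF_greatest[OF C that])
  have u_nonneg: "0 \<le> u x" for x by (rule greatest) (rule nonneg)
  have approx: "\<exists>t\<in>C. t x < u x + e \<and> t y < u y + e" if e: "0 < e" for e x y
  proof -
    have "\<exists>t\<in>C. t z < u z + e" for z
      using cINF_less_iff[OF C bdd, of z "u z + e"] e by (simp add: u_def)
    then obtain t t' where "t \<in> C" "t x < u x + e" "t' \<in> C" "t' y < u y + e" by blast
    then show ?thesis
      using chain[of t t'] unfolding le_fun_def by (meson le_less_trans)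
  qed
  show seminorm: "commutative_algebra_seminorm smul u"
  proof (rule commutative_algebra_seminormI)
    fix x y c
    have "u (x + y) \<le> (u x + e) + (u y + e)" if e: "0 < e" for e
    proof -
      obtain t where t: "t \<in> C" "t x < u x + e" "t y < u y + e" using approx[OF e] by blast
      have "t (x + y) \<le> t x + t y"
        using seminorms[OF t(1)] algebra_seminorm.seminorm_triangle
        by (auto simp: commutative_algebra_seminorm_def)
      with lower[OF t(1), of "x + y"] t show ?thesis by linarith
    qed
    then have "u (x + y) \<le> (u x + 0) + (u y + 0)"
      by (intro le_at_zeroI[of "\<lambda>e. (u x + e) + (u y + e)"] continuous_intros)
    then show "u (x + y) \<le> u x + u y" by simp
    have "u (x * y) \<le> (u x + e) * (u y + e)" if e: "0 < e" for e
    proof -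
      obtain t where t: "t \<in> C" "t x < u x + e" "t y < u y + e" using approx[OF e] by blast
      have "u (x * y) \<le> t x * t y"
        using seminorms[OF t(1)] algebra_seminorm.seminorm_mult
        by (intro order.trans[OF lower[OF t(1), of "x * y"]])
          (auto simp: commutative_algebra_seminorm_def)
      also have "\<dots> \<le> (u x + e) * (u y + e)"
        using t nonneg[OF t(1)] e u_nonneg[of x] by (intro mult_mono) auto
      finally show ?thesis .
    qed
    then have "u (x * y) \<le> (u x + 0) * (u y + 0)"
      by (intro le_at_zeroI[of "\<lambda>e. (u x + e) * (u y + e)"] continuous_intros)
    then show "u (x * y) \<le> u x * u y" by simp
    have scale: "t (smul c x) = cmod c * t x" if "t \<in> C" for t c x
      using seminorms[OF that] algebra_seminorm.seminorm_scale
      by (auto simp: commutative_algebra_seminorm_def)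
    have le: "cmod c * u x \<le> u (smul c x)" for c x
      by (rule greatest) (simp add: scale lower mult_left_mono)
    show "u (smul c x) = cmod c * u x"
    proof (cases "c = 0")
      case True
      obtain t where "t \<in> C" using C by blast
      then have "u (smul c x) \<le> 0" using lower[of t "smul c x"] scale[of t c x] True by simp
      with True u_nonneg[of "smul c x"] show ?thesis by simp
    next
      case False
      have "cmod (inverse c) * u (smul c x) \<le> u x" using le[of "inverse c" "smul c x"] False by simp
      then have "u (smul c x) \<le> cmod c * u x" using False by (simp add: norm_divide field_simps)
      with le show ?thesis by (intro antisym)
    qed
  qed
  show "uniform_norm u"
    unfolding uniform_norm_def
  proof
    fix x
    have "(u x)\<^sup>2 \<le> u (x * x)"
    proof (rule greatest)
      fix t assume t: "t \<in> C"
      then have "t (x * x) = (t x)\<^sup>2" using seminorms by (auto simp: uniform_norm_def)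
      then show "(u x)\<^sup>2 \<le> t (x * x)" using lower[OF t, of x] u_nonneg[of x] by (simp add: power_mono)
    qed
    moreover have "u (x * x) \<le> u x * u x"
      using seminorm algebra_seminorm.seminorm_mult by (auto simp: commutative_algebra_seminorm_def)
    ultimately show "u (x * x) = (u x)\<^sup>2" by (simp add: power2_eq_square)
  qed
qed

text \<open>If \<^term>\<open>t\<close> is minimal among the uniform seminorms below \<^term>\<open>s\<close> that agree with \<^term>\<open>s\<close> at
  \<^term>\<open>x0\<close>, then the orbit seminorms of \<^term>\<open>t\<close>, first at \<^term>\<open>x0\<close> and then at any other point,
  must coincide with \<^term>\<open>t\<close>.\<close>

lemma multiplicative_seminorm_exists:
  assumes u: "uniform_norm s" and x0: "0 < s x0"
  obtains t where "commutative_algebra_seminorm smul t" "\<And>x. t x \<le> s x" "t x0 = s x0"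
    "\<And>x y. t (x * y) = t x * t y"
proof -
  define A where "A = {t. commutative_algebra_seminorm smul t \<and> uniform_norm t \<and> t \<le> s \<and> t x0 = s x0}"
  have "\<exists>m\<in>A. \<forall>a\<in>A. m \<ge> a \<longrightarrow> a = m"
  proof (rule predicate_Zorn)
    show "partial_order_on A (relation_of (\<ge>) A)"
      by (rule partial_order_on_relation_ofI) auto
    fix C assume "C \<in> Chains (relation_of (\<ge>) A)"
    then have CA: "C \<subseteq> A" and chain: "\<And>t t'. t \<in> C \<Longrightarrow> t' \<in> C \<Longrightarrow> t \<le> t' \<or> t' \<le> t"
      unfolding Chains_def relation_of_def by blast+
    show "\<exists>u\<in>A. \<forall>a\<in>C. a \<ge> u"
    proof (cases "C = {}")
      case True
      have "s \<in> A" using u commutative_algebra_seminorm_axioms by (simp add: A_def)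
      with True show ?thesis by blast
    next
      case False
      define v where "v x = (INF t\<in>C. t x)" for x
      have v: "commutative_algebra_seminorm smul v" "uniform_norm v" "\<And>t. t \<in> C \<Longrightarrow> v \<le> t"
        using chain_infimum[OF False _ chain] CA unfolding v_def A_def by blast+
      have "v x0 = (INF t\<in>C. s x0)"
        using CA unfolding v_def A_def by (intro INF_cong) auto
      then have "v x0 = s x0" using False by simp
      moreover obtain t where t: "t \<in> C" using False by blast
      then have "v \<le> s" using v(3)[of t] CA by (auto simp: A_def)
      ultimately have "v \<in> A" using v by (simp add: A_def)
      with v(3) show ?thesis by blast
    qed
  qed
  then obtain t where t: "t \<in> A" and minimal: "\<And>a. a \<in> A \<Longrightarrow> a \<le> t \<Longrightarrow> a = t" by blast
  interpret t: commutative_algebra_seminorm smul t using t by (simp add: A_def)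
  have ut: "uniform_norm t" "t \<le> s" "t x0 = s x0" using t by (auto simp: A_def)
  have orbit: "t.orbit_seminorm y = t" if y: "0 < t y" and eq: "t.orbit_seminorm y x0 = t x0" for y
  proof (rule minimal)
    show le: "t.orbit_seminorm y \<le> t" using t.orbit_seminorm_le[OF y] by (simp add: le_fun_def)
    then show "t.orbit_seminorm y \<in> A"
      using ut eq t.orbit_seminorm_algebra_seminorm[OF y] t.orbit_seminorm_uniform[OF ut(1) y]
      by (auto simp: A_def)
  qed
  have tx0: "0 < t x0" using x0 ut by simp
  then have "t.orbit_seminorm x0 = t"
    using orbit t.orbit_seminorm_self[OF ut(1)] by simp
  then have "t (x * x0) = t x * t x0" for x
    using t.orbit_seminorm_mult_self[OF tx0, of x] by simp
  then have x0_mult: "t (x0 * x) = t x0 * t x" for x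
    using mult_commute[of x0 x] by (simp add: mult.commute)
  show ?thesis
  proof
    show "commutative_algebra_seminorm smul t" by (rule t.commutative_algebra_seminorm_axioms)
    show "t x \<le> s x" for x using ut(2) by (simp add: le_fun_def)
    show "t x0 = s x0" by (rule ut(3))
    show "t (x * y) = t x * t y" for x y
    proof (cases "t y = 0")
      case True
      then show ?thesis using t.seminorm_mult[of x y] by (simp add: antisym)
    next
      case False
      then have y: "0 < t y" by (simp add: less_le)
      then have "t.orbit_seminorm y = t"
        using t.orbit_seminorm_eq[OF ut(1) y x0_mult] orbit by simp
      then show ?thesis using t.orbit_seminorm_mult_self[OF y, of x] by simp
    qed
  qed
qed

end

subsection \<open>Multiplicative seminorms and characters\<close>

locale multiplicative_seminorm = commutative_algebra_seminorm smul s
  for smul :: "complex \<Rightarrow> 'a::ring_1 \<Rightarrow> 'a" and s +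
  assumes multiplicative: "s (x * y) = s x * s y"
    and seminorm_one: "s 1 = 1"
begin

lemma seminorm_power: "s (x ^ n) = s x ^ n"
  by (induction n) (simp_all add: multiplicative seminorm_one)

lemma seminorm_scalar: "s (smul c 1) = cmod c"
  by (simp add: seminorm_scale seminorm_one)

lemma difference_of_squares: "x * x - smul (c * c) 1 = (x - smul c 1) * (x + smul c 1)"
  by (simp add: algebra_simps smul_mult_left smul_mult_right)

text \<open>Repeated complex square roots split the element into \<open>2 ^ k\<close> linear factors
  \<open>y - d\<close>, each of seminorm at least \<open>m\<close>.\<close>

lemma seminorm_pow2_diff_ge:
  assumes "0 \<le> m" and m: "\<And>c. m \<le> s (y - smul c 1)"
  shows "m ^ 2 ^ k \<le> s (y ^ 2 ^ k - smul c 1)"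
proof (induction k arbitrary: c)
  case (Suc k)
  have "m ^ 2 ^ k * m ^ 2 ^ k \<le> s (y ^ 2 ^ k - smul (csqrt c) 1) * s (y ^ 2 ^ k - smul (- csqrt c) 1)"
    using \<open>0 \<le> m\<close> by (intro mult_mono Suc) auto
  also have "\<dots> = s (y ^ 2 ^ k * y ^ 2 ^ k - smul (csqrt c * csqrt c) 1)"
    by (simp only: difference_of_squares multiplicative) simp
  finally show ?case
    by (simp only: power_two_power_Suc power2_eq_square[symmetric, of "csqrt c"] power2_csqrt)
qed (simp add: m)

text \<open>Ostrowski's argument: \<^term>\<open>y - c\<close> divides \<^term>\<open>y ^ n - c ^ n\<close>, and all the other linear
  factors have seminorm at least \<^term>\<open>m\<close>. Taking for \<^term>\<open>n\<close> the powers of two makes the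
  factorisation an iterated difference of squares.\<close>

lemma seminorm_constant_near_minimum:
  assumes pos: "0 < m" and m: "\<And>c. m \<le> s (y - smul c 1)" and y: "s y = m" and c: "cmod c < m"
  shows "s (y - smul c 1) = m"
proof (rule antisym)
  have le: "s (y - smul c 1) * m ^ 2 ^ k \<le> m * s (y ^ 2 ^ k - smul (c ^ 2 ^ k) 1)" for k
  proof (induction k)
    case (Suc k)
    let ?Y = "y ^ 2 ^ k" and ?C = "c ^ 2 ^ k"
    have "s (y - smul c 1) * m ^ 2 ^ k * m ^ 2 ^ k
        \<le> (m * s (?Y - smul ?C 1)) * s (?Y - smul (- ?C) 1)"
      using pos by (intro mult_mono Suc seminorm_pow2_diff_ge m) auto
    also have "\<dots> = m * s (?Y * ?Y - smul (?C * ?C) 1)"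
      by (simp only: difference_of_squares multiplicative) simp
    finally show ?case
      by (simp only: power_two_power_Suc mult.assoc)
  qed simp
  have "s (y - smul c 1) \<le> m * (1 + (cmod c / m) ^ 2 ^ k)" for k
  proof -
    have "s (y ^ 2 ^ k - smul (c ^ 2 ^ k) 1) \<le> m ^ 2 ^ k + cmod c ^ 2 ^ k"
      using seminorm_diff[of "y ^ 2 ^ k" "smul (c ^ 2 ^ k) 1"]
      by (simp add: seminorm_power y seminorm_scalar norm_power)
    then have "s (y - smul c 1) * m ^ 2 ^ k \<le> m * (m ^ 2 ^ k + cmod c ^ 2 ^ k)"
      using le[of k] pos by (meson mult_left_mono less_imp_le order.trans)
    also have "\<dots> = m * (1 + (cmod c / m) ^ 2 ^ k) * m ^ 2 ^ k"
      using pos by (simp add: power_divide field_simps)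
    finally show ?thesis using pos by simp
  qed
  moreover have "(\<lambda>k. m * (1 + (cmod c / m) ^ 2 ^ k)) \<longlonglongrightarrow> m * (1 + 0)"
  proof (intro tendsto_intros)
    have "(\<lambda>n. (cmod c / m) ^ n) \<longlonglongrightarrow> 0"
      using pos c by (intro LIMSEQ_realpow_zero) auto
    moreover have "strict_mono (\<lambda>k::nat. 2 ^ k :: nat)" by (simp add: strict_mono_def)
    ultimately show "(\<lambda>k. (cmod c / m) ^ 2 ^ k) \<longlonglongrightarrow> 0"
      using LIMSEQ_subseq_LIMSEQ[of "\<lambda>n. (cmod c / m) ^ n" 0 "\<lambda>k. 2 ^ k"] by (simp add: o_def)
  qed
  ultimately have "s (y - smul c 1) \<le> m * (1 + 0)"
    by (intro LIMSEQ_le_const) auto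
  then show "s (y - smul c 1) \<le> m" by simp
qed (rule m)

text \<open>If the distance from \<open>x\<close> to the scalars had a positive minimum
  \<open>m\<close>, it would equal \<open>m\<close> on a whole disc of radius \<open>m\<close>
  around each minimiser. Steps of length \<open>m / 2\<close> would then lead arbitrarily far at
  constant distance, although the distance grows with the scalar.\<close>

lemma gelfand_mazur: "\<exists>c. s (x - smul c 1) = 0"
proof -
  define g where "g c = s (x - smul c 1)" for c
  have lipschitz: "g c \<le> g d + cmod (d - c)" for c d
  proof -
    have "x - smul c 1 = (x - smul d 1) + smul (d - c) 1"
      by (simp add: scale_left_diff_distrib)
    then show ?thesis
      using seminorm_triangle[of "x - smul d 1" "smul (d - c) 1"]
      by (simp only: g_def seminorm_scalar)
  qed
  \<comment> \<open>Outside this disc \<open>g c\<close> is at least \<open>cmod c - s x\<close>,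
    which exceeds \<open>s x = g 0\<close>, so the minimum over the disc is global.\<close>
  have "continuous_on (cball 0 (2 * s x)) g"
    unfolding continuous_on_iff
  proof (intro ballI allI impI)
    fix c and e :: real assume "0 < e"
    moreover have "dist (g d) (g c) \<le> dist d c" for d
      using lipschitz[of c d] lipschitz[of d c] by (simp add: dist_norm norm_minus_commute abs_le_iff)
    ultimately show "\<exists>d>0. \<forall>c'\<in>cball 0 (2 * s x). dist c' c < d \<longrightarrow> dist (g c') (g c) < e"
      by (meson le_less_trans)
  qed
  moreover have "cball (0::complex) (2 * s x) \<noteq> {}" by (simp add: not_less)
  ultimately obtain l where l: "\<And>c. c \<in> cball 0 (2 * s x) \<Longrightarrow> g l \<le> g c"
    using continuous_attains_inf[OF compact_cball] by metis
  have min: "g l \<le> g c" for c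
  proof (cases "cmod c \<le> 2 * s x")
    case False
    have "g l \<le> g 0" by (rule l) simp
    also have "\<dots> \<le> g c"
      using seminorm_diff_ge[of "smul c 1" x] False
      by (simp add: g_def seminorm_scalar seminorm_minus_commute[of x])
    finally show ?thesis .
  qed (simp add: l)
  define m where "m = g l"
  show ?thesis
  proof (cases "m = 0")
    case True
    then show ?thesis by (auto simp: m_def g_def)
  next
    case False
    then have pos: "0 < m" by (simp add: m_def g_def less_le)
    have "g (l + of_nat k * of_real (m / 2)) = m" for k
    proof (induction k)
      case (Suc k)
      define y where "y = x - smul (l + of_nat k * of_real (m / 2)) 1"
      have shift: "y - smul c 1 = x - smul (l + of_nat k * of_real (m / 2) + c) 1" for c
        by (simp add: y_def scale_left_distrib)
      have "s (y - smul (of_real (m / 2)) 1) = m"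
      proof (rule seminorm_constant_near_minimum[OF pos])
        show "m \<le> s (y - smul c 1)" for c
          using min unfolding shift m_def g_def by blast
        show "s y = m" using Suc by (simp add: y_def g_def)
        show "cmod (of_real (m / 2)) < m" using pos by simp
      qed
      moreover have "l + of_nat (Suc k) * of_real (m / 2) = l + of_nat k * of_real (m / 2) + of_real (m / 2)"
        by (simp add: algebra_simps add_divide_distrib)
      ultimately show ?case unfolding g_def by (simp only: shift)
    qed (simp add: m_def)
    \<comment> \<open>Five steps cover \<open>5 * m / 2\<close>, more than the \<open>2 * m\<close>
      that two scalars at distance \<open>m\<close> from \<open>x\<close> can be apart.\<close>
    from this[of 5] have "g (l + of_real (5 * m / 2)) = m" by simp
    moreover have "l + of_real (5 * m / 2) - l = of_real (5 * m / 2)" by simp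
    moreover have "cmod c \<le> g l + g (l + c)" for c
    proof -
      have "smul c 1 = (x - smul l 1) - (x - smul (l + c) 1)" by (simp add: scale_left_distrib)
      then show ?thesis
        using seminorm_diff[of "x - smul l 1" "x - smul (l + c) 1"] seminorm_scalar[of c]
        by (simp add: g_def)
    qed
    from this[of "of_real (5 * m / 2)"] have "5 * m / 2 \<le> g l + g (l + of_real (5 * m / 2))"
      using pos by simp
    ultimately show ?thesis using pos by (simp add: m_def)
  qed
qed

text \<open>The scalar given by \<open>gelfand_mazur\<close> is unique because \<open>s\<close> is
  the modulus on scalars. Each law for \<open>f\<close> then follows by checking that the expected
  value has distance 0.\<close>

lemma character_exists: "\<exists>f\<in>characters smul. \<forall>x. cmod (f x) = s x"
proof -
  from gelfand_mazur have "\<forall>x. \<exists>c. s (x - smul c 1) = 0" by blast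
  then obtain f where f: "\<And>x. s (x - smul (f x) 1) = 0" by metis
  have unique: "f x = c" if "s (x - smul c 1) \<le> 0" for x c
  proof -
    have "smul (f x - c) 1 = (x - smul c 1) - (x - smul (f x) 1)"
      by (simp add: scale_left_diff_distrib)
    then have "cmod (f x - c) \<le> s (x - smul c 1) + s (x - smul (f x) 1)"
      by (metis seminorm_diff seminorm_scalar)
    then have "cmod (f x - c) \<le> 0" using that f[of x] by linarith
    then show ?thesis by simp
  qed
  have add: "f (x + y) = f x + f y" for x y
  proof (rule unique)
    have "x + y - smul (f x + f y) 1 = (x - smul (f x) 1) + (y - smul (f y) 1)"
      by (simp add: scale_left_distrib)
    then show "s (x + y - smul (f x + f y) 1) \<le> 0"
      by (metis seminorm_triangle f add_0)
  qed
  have scale: "f (smul c x) = c * f x" for c x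
  proof (rule unique)
    have "smul c x - smul (c * f x) 1 = smul c (x - smul (f x) 1)"
      by (simp add: scale_right_diff_distrib)
    then show "s (smul c x - smul (c * f x) 1) \<le> 0" by (simp add: seminorm_scale f)
  qed
  have mult: "f (x * y) = f x * f y" for x y
  proof (rule unique)
    have "x * y - smul (f x * f y) 1 = (x - smul (f x) 1) * y + smul (f x) (y - smul (f y) 1)"
      by (simp add: algebra_simps smul_mult_left scale_right_diff_distrib)
    then have "s (x * y - smul (f x * f y) 1)
        \<le> s ((x - smul (f x) 1) * y) + s (smul (f x) (y - smul (f y) 1))"
      by (metis seminorm_triangle)
    then show "s (x * y - smul (f x * f y) 1) \<le> 0" by (simp add: multiplicative seminorm_scale f)
  qed
  have "f 1 = 1" by (rule unique) simp
  moreover have "Vector_Spaces.linear smul (*) f"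
    using add scale by unfold_locales (auto simp: algebra_simps)
  ultimately have "f \<in> characters smul"
    using mult by (auto simp: characters_def intro!: exI[of _ 1])
  moreover have "cmod (f x) = s x" for x
    using seminorm_diff_ge[of x "smul (f x) 1"] seminorm_diff_ge[of "smul (f x) 1" x]
      seminorm_minus_commute[of x "smul (f x) 1"] f[of x]
    by (simp add: seminorm_scalar)
  ultimately show ?thesis by blast
qed

end

context commutative_algebra_seminorm
begin

lemma uniform_character_exists:
  assumes u: "uniform_norm s" and x0: "0 < s x0"
  obtains f where "f \<in> characters smul" "\<And>x. cmod (f x) \<le> s x" "cmod (f x0) = s x0"
proof -
  obtain t where t: "commutative_algebra_seminorm smul t" "\<And>x. t x \<le> s x" "t x0 = s x0"
    "\<And>x y. t (x * y) = t x * t y"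
    using multiplicative_seminorm_exists[OF u x0] by blast
  have "t 1 = 1" using t(4)[of x0 1] t(3) x0 by simp
  then interpret t: multiplicative_seminorm smul t
    using t by (simp add: multiplicative_seminorm_def multiplicative_seminorm_axioms_def)
  show ?thesis using t.character_exists t that by metis
qed

text \<open>The spectral radius supplies a uniform seminorm below \<open>s\<close>, and the
  hypothesis on the unit keeps it from vanishing.\<close>

lemma character_exists_below:
  assumes "1 \<le> s 1"
  obtains f where "f \<in> characters smul" "\<And>x. cmod (f x) \<le> s x"
proof -
  interpret r: commutative_algebra_seminorm smul spectral_seminorm
    by (rule spectral_seminorm_algebra_seminorm)
  have "0 < spectral_seminorm 1" using spectral_seminorm_one[OF assms] by simp
  then obtain f where "f \<in> characters smul" "\<And>x. cmod (f x) \<le> spectral_seminorm x"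
    using r.uniform_character_exists[OF spectral_seminorm_uniform] by blast
  then show ?thesis using spectral_seminorm_le that by (meson order.trans)
qed

end

subsection \<open>Ideals of the completion\<close>

lemma (in ring) left_ideal_extend:
  assumes I: "left_ideal I R" and s: "s \<in> carrier R"
  shows "left_ideal {a \<otimes> s \<oplus> i | a i. a \<in> carrier R \<and> i \<in> I} R"
proof -
  interpret I: additive_subgroup I R using I by (simp add: left_ideal_def)
  have I_mult: "r \<otimes> i \<in> I" if "r \<in> carrier R" "i \<in> I" for r i
    using I that by (simp add: left_ideal_def)
  have sub: "i \<in> carrier R" if "i \<in> I" for i using that I.a_subset by blast
  define K where "K = {a \<otimes> s \<oplus> i | a i. a \<in> carrier R \<and> i \<in> I}"
  have "subgroup K (add_monoid R)"
  proof (rule add.subgroupI)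
    show "K \<subseteq> carrier R" using s sub by (auto simp: K_def)
    have "\<zero> \<otimes> s \<oplus> \<zero> \<in> K" using I.zero_closed unfolding K_def by blast
    then show "K \<noteq> {}" by blast
    fix x assume "x \<in> K"
    then obtain a i where x: "x = a \<otimes> s \<oplus> i" "a \<in> carrier R" "i \<in> I" by (auto simp: K_def)
    then have "\<ominus> x = (\<ominus> a) \<otimes> s \<oplus> (\<ominus> i)"
      using s sub by (simp add: minus_add l_minus a_comm)
    then show "\<ominus> x \<in> K" using x I.a_inv_closed abelian_group_axioms by (auto simp: K_def)
    fix y assume "y \<in> K"
    then obtain b j where y: "y = b \<otimes> s \<oplus> j" "b \<in> carrier R" "j \<in> I" by (auto simp: K_def)
    have "x \<oplus> y = (a \<oplus> b) \<otimes> s \<oplus> (i \<oplus> j)"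
      using x y s sub by (simp add: l_distr a_ac)
    moreover have "i \<oplus> j \<in> I" using x y by simp
    ultimately show "x \<oplus> y \<in> K" using x y by (auto simp: K_def)
  qed
  moreover have "r \<otimes> x \<in> K" if r: "r \<in> carrier R" and "x \<in> K" for r x
  proof -
    obtain a i where x: "x = a \<otimes> s \<oplus> i" "a \<in> carrier R" "i \<in> I"
      using \<open>x \<in> K\<close> by (auto simp: K_def)
    then have "r \<otimes> x = (r \<otimes> a) \<otimes> s \<oplus> r \<otimes> i" using r s sub by (simp add: r_distr m_assoc)
    then show ?thesis using x r I_mult by (auto simp: K_def)
  qed
  ultimately show ?thesis
    by (simp add: left_ideal_def additive_subgroup_def flip: K_def)
qed

text \<open>By maximality the left ideal generated by \<open>s\<close> and \<open>I\<close> is the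
  whole ring, hence contains the unit.\<close>

lemma (in ring) maximal_left_ideal_comaximal:
  assumes I: "maximal_left_ideal I R" and s: "s \<in> carrier R" "s \<notin> I"
  obtains a i where "a \<in> carrier R" "i \<in> I" "a \<otimes> s \<oplus> i = \<one>"
proof -
  have left: "left_ideal I R" using I by (simp add: maximal_left_ideal_def)
  interpret I: additive_subgroup I R using left by (simp add: left_ideal_def)
  define K where "K = {a \<otimes> s \<oplus> i | a i. a \<in> carrier R \<and> i \<in> I}"
  have "left_ideal K R" unfolding K_def by (rule left_ideal_extend[OF left s(1)])
  moreover have "I \<subseteq> K"
  proof
    fix i assume i: "i \<in> I"
    then have "i = \<zero> \<otimes> s \<oplus> i" using s(1) I.a_subset by auto
    with i show "i \<in> K" unfolding K_def by blast
  qed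
  moreover have "s = \<one> \<otimes> s \<oplus> \<zero>" using s(1) by simp
  then have "s \<in> K" unfolding K_def using I.zero_closed by blast
  ultimately have "K = carrier R" using I s by (metis maximal_left_ideal_def)
  then have "\<one> \<in> K" by simp
  then show ?thesis using that unfolding K_def by force
qed

section \<open>The ring of Cauchy sequences and the ideal of null sequences\<close>

context algebra_norm
begin

lemma Metric_space_norm_dist: "Metric_space UNIV (norm_dist p)"
proof
  show "norm_dist p x y = norm_dist p y x" for x y
    by (simp add: norm_dist_def seminorm_minus_commute)
  show "norm_dist p x z \<le> norm_dist p x y + norm_dist p y z" for x y z
    using triangle[of "x - y" "y - z"] by (simp add: norm_dist_def)
qed (auto simp: norm_dist_def eq_zero_iff)

lemma cauchy_ring_carrier_iff:
  "\<sigma> \<in> carrier (cauchy_ring p) \<longleftrightarrow> (\<forall>e>0. \<exists>N. \<forall>m n. N \<le> m \<longrightarrow> N \<le> n \<longrightarrow> p (\<sigma> m - \<sigma> n) < e)"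
  by (simp add: cauchy_ring_def Metric_space.MCauchy_def[OF Metric_space_norm_dist] norm_dist_def)

text \<open>One criterion for three uses: null sequences (\<open>C = 0\<close>), scalar multiples
  (\<open>\<delta> = 0\<close>), and the approximate inverses of the Neumann series, where both
  error terms occur.\<close>

lemma cauchy_ring_carrierI:
  assumes \<delta>: "\<delta> \<longlonglongrightarrow> 0" and le: "\<And>m n. N \<le> m \<Longrightarrow> N \<le> n \<Longrightarrow> p (\<sigma> m - \<sigma> n) \<le> \<delta> m + \<delta> n + C * p (\<tau> m - \<tau> n)"
    and \<tau>: "\<tau> \<in> carrier (cauchy_ring p)"
  shows "\<sigma> \<in> carrier (cauchy_ring p)"
  unfolding cauchy_ring_carrier_iff
proof (intro allI impI)
  fix e :: real assume e: "0 < e"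
  obtain N1 where N1: "\<And>n. N1 \<le> n \<Longrightarrow> \<delta> n < e / 4"
    using order_tendstoD(2)[OF \<delta>, of "e / 4"] e by (auto simp: eventually_sequentially)
  have "0 < e / (2 * (\<bar>C\<bar> + 1))" using e by simp
  then obtain N2 where N2: "\<And>m n. N2 \<le> m \<Longrightarrow> N2 \<le> n \<Longrightarrow> p (\<tau> m - \<tau> n) < e / (2 * (\<bar>C\<bar> + 1))"
    using \<tau> unfolding cauchy_ring_carrier_iff by meson
  show "\<exists>N. \<forall>m n. N \<le> m \<longrightarrow> N \<le> n \<longrightarrow> p (\<sigma> m - \<sigma> n) < e"
  proof (intro exI allI impI)
    fix m n assume mn: "max N (max N1 N2) \<le> m" "max N (max N1 N2) \<le> n"
    have "C * p (\<tau> m - \<tau> n) \<le> (\<bar>C\<bar> + 1) * p (\<tau> m - \<tau> n)"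
      by (intro mult_right_mono) (auto simp: nonneg)
    also have "\<dots> \<le> (\<bar>C\<bar> + 1) * (e / (2 * (\<bar>C\<bar> + 1)))"
      using N2[of m n] mn by (intro mult_left_mono) auto
    also have "\<dots> = e / 2" by (simp add: field_simps)
    finally show "p (\<sigma> m - \<sigma> n) < e"
      using le[of m n] N1[of m] N1[of n] mn by simp
  qed
qed

lemma cauchy_bounded:
  assumes "\<sigma> \<in> carrier (cauchy_ring p)"
  obtains B where "0 \<le> B" "\<And>n. p (\<sigma> n) \<le> B"
proof -
  obtain N where N: "\<And>m n. N \<le> m \<Longrightarrow> N \<le> n \<Longrightarrow> p (\<sigma> m - \<sigma> n) < 1"
    using assms unfolding cauchy_ring_carrier_iff by (meson zero_less_one)
  define B where "B = (\<Sum>i<N. p (\<sigma> i)) + p (\<sigma> N) + 1"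
  have "p (\<sigma> n) \<le> B" for n
  proof (cases "n < N")
    case True
    then have "p (\<sigma> n) \<le> (\<Sum>i<N. p (\<sigma> i))"
      by (intro member_le_sum) (auto simp: nonneg)
    then show ?thesis unfolding B_def using nonneg[of "\<sigma> N"] by linarith
  next
    case False
    then have "p (\<sigma> n) - p (\<sigma> N) < 1"
      using N[of n N] seminorm_diff_ge[of "\<sigma> n" "\<sigma> N"] by simp
    moreover have "0 \<le> (\<Sum>i<N. p (\<sigma> i))" by (intro sum_nonneg nonneg)
    ultimately show ?thesis by (simp add: B_def)
  qed
  then show ?thesis using that[of B] nonneg order.trans by blast
qed

lemma cauchy_const [simp]: "(\<lambda>_. x) \<in> carrier (cauchy_ring p)"
  by (simp add: cauchy_ring_carrier_iff)

lemma null_sequence_cauchy: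
  assumes "\<sigma> \<in> null_sequences p"
  shows "\<sigma> \<in> carrier (cauchy_ring p)"
  using assms seminorm_diff
  by (intro cauchy_ring_carrierI[of "\<lambda>n. p (\<sigma> n)" 0 \<sigma> 0 "\<lambda>_. 0"]) (auto simp: null_sequences_def)

lemma cauchy_add:
  assumes \<sigma>: "\<sigma> \<in> carrier (cauchy_ring p)" and \<tau>: "\<tau> \<in> carrier (cauchy_ring p)"
  shows "(\<lambda>n. \<sigma> n + \<tau> n) \<in> carrier (cauchy_ring p)"
  unfolding cauchy_ring_carrier_iff
proof (intro allI impI)
  fix e :: real assume e: "0 < e"
  then have "0 < e / 2" by simp
  then obtain N1 N2 where N: "\<And>m n. N1 \<le> m \<Longrightarrow> N1 \<le> n \<Longrightarrow> p (\<sigma> m - \<sigma> n) < e / 2"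
    "\<And>m n. N2 \<le> m \<Longrightarrow> N2 \<le> n \<Longrightarrow> p (\<tau> m - \<tau> n) < e / 2"
    using \<sigma> \<tau> unfolding cauchy_ring_carrier_iff by meson
  have "p (\<sigma> m + \<tau> m - (\<sigma> n + \<tau> n)) < e" if "max N1 N2 \<le> m" "max N1 N2 \<le> n" for m n
    using triangle[of "\<sigma> m - \<sigma> n" "\<tau> m - \<tau> n"] N(1)[of m n] N(2)[of m n] that
    by (simp add: algebra_simps)
  then show "\<exists>N. \<forall>m n. N \<le> m \<longrightarrow> N \<le> n \<longrightarrow> p (\<sigma> m + \<tau> m - (\<sigma> n + \<tau> n)) < e" by blast
qed

lemma cauchy_scale:
  assumes "\<sigma> \<in> carrier (cauchy_ring p)"
  shows "(\<lambda>n. smul c (\<sigma> n)) \<in> carrier (cauchy_ring p)"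
proof (rule cauchy_ring_carrierI[OF tendsto_const _ assms])
  show "p (smul c (\<sigma> m) - smul c (\<sigma> n)) \<le> 0 + 0 + cmod c * p (\<sigma> m - \<sigma> n)" for m n
    unfolding scale_right_diff_distrib[symmetric] homogeneous by simp
qed

lemma cauchy_minus:
  assumes "\<sigma> \<in> carrier (cauchy_ring p)"
  shows "(\<lambda>n. - \<sigma> n) \<in> carrier (cauchy_ring p)"
  using cauchy_scale[OF assms, of "- 1"] by simp

lemma cauchy_mult:
  assumes \<sigma>: "\<sigma> \<in> carrier (cauchy_ring p)" and \<tau>: "\<tau> \<in> carrier (cauchy_ring p)"
  shows "(\<lambda>n. \<sigma> n * \<tau> n) \<in> carrier (cauchy_ring p)"
  unfolding cauchy_ring_carrier_iff
proof (intro allI impI)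
  fix e :: real assume e: "0 < e"
  obtain B where B: "0 \<le> B" "\<And>n. p (\<sigma> n) \<le> B" using cauchy_bounded[OF \<sigma>] by blast
  obtain C where C: "0 \<le> C" "\<And>n. p (\<tau> n) \<le> C" using cauchy_bounded[OF \<tau>] by blast
  define r where "r = e / (B + C + 1)"
  have "0 < r" using e B(1) C(1) by (simp add: r_def)
  then obtain N1 N2 where N: "\<And>m n. N1 \<le> m \<Longrightarrow> N1 \<le> n \<Longrightarrow> p (\<sigma> m - \<sigma> n) < r"
    "\<And>m n. N2 \<le> m \<Longrightarrow> N2 \<le> n \<Longrightarrow> p (\<tau> m - \<tau> n) < r"
    using \<sigma> \<tau> unfolding cauchy_ring_carrier_iff by meson
  have "p (\<sigma> m * \<tau> m - \<sigma> n * \<tau> n) < e" if mn: "max N1 N2 \<le> m" "max N1 N2 \<le> n" for m n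
  proof -
    have "\<sigma> m * \<tau> m - \<sigma> n * \<tau> n = \<sigma> m * (\<tau> m - \<tau> n) + (\<sigma> m - \<sigma> n) * \<tau> n"
      by (simp add: algebra_simps)
    then have "p (\<sigma> m * \<tau> m - \<sigma> n * \<tau> n)
        \<le> p (\<sigma> m) * p (\<tau> m - \<tau> n) + p (\<sigma> m - \<sigma> n) * p (\<tau> n)"
      by (simp only:) (intro order.trans[OF triangle] add_mono submultiplicative)
    also have "\<dots> \<le> B * r + r * C"
      using B C N(1)[of m n] N(2)[of m n] mn \<open>0 < r\<close>
      by (intro add_mono mult_mono) (auto simp: nonneg)
    also have "\<dots> < (B + C + 1) * r" using \<open>0 < r\<close> by (simp add: algebra_simps)
    also have "\<dots> = e" using B(1) C(1) by (simp add: r_def)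
    finally show ?thesis .
  qed
  then show "\<exists>N. \<forall>m n. N \<le> m \<longrightarrow> N \<le> n \<longrightarrow> p (\<sigma> m * \<tau> m - \<sigma> n * \<tau> n) < e" by blast
qed

lemma cauchy_ring_simps:
  "\<sigma> \<otimes>\<^bsub>cauchy_ring p\<^esub> \<tau> = (\<lambda>n. \<sigma> n * \<tau> n)" "\<sigma> \<oplus>\<^bsub>cauchy_ring p\<^esub> \<tau> = (\<lambda>n. \<sigma> n + \<tau> n)"
  "\<one>\<^bsub>cauchy_ring p\<^esub> = (\<lambda>_. 1)" "\<zero>\<^bsub>cauchy_ring p\<^esub> = (\<lambda>_. 0)"
  by (simp_all add: cauchy_ring_def)

lemma cauchy_ring_is_ring: "ring (cauchy_ring p)"
proof (rule ringI)
  show "abelian_group (cauchy_ring p)"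
  proof (rule abelian_groupI)
    fix \<sigma> assume "\<sigma> \<in> carrier (cauchy_ring p)"
    then show "\<exists>\<tau>\<in>carrier (cauchy_ring p). \<tau> \<oplus>\<^bsub>cauchy_ring p\<^esub> \<sigma> = \<zero>\<^bsub>cauchy_ring p\<^esub>"
      by (intro bexI[of _ "\<lambda>n. - \<sigma> n"]) (auto simp: cauchy_ring_simps cauchy_minus)
  qed (auto simp: cauchy_ring_simps cauchy_add add_ac)
  show "Group.monoid (cauchy_ring p)"
    by (rule Group.monoidI) (auto simp: cauchy_ring_simps cauchy_mult mult.assoc)
qed (auto simp: cauchy_ring_simps algebra_simps)

lemma null_sequences_ideal: "ideal (null_sequences p) (cauchy_ring p)"
proof (rule idealI[OF cauchy_ring_is_ring])
  interpret R: ring "cauchy_ring p" by (rule cauchy_ring_is_ring)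
  show "subgroup (null_sequences p) (add_monoid (cauchy_ring p))"
  proof (rule R.add.subgroupI)
    show "null_sequences p \<subseteq> carrier (cauchy_ring p)" using null_sequence_cauchy by blast
    have "(\<lambda>_. 0) \<in> null_sequences p" by (simp add: null_sequences_def)
    then show "null_sequences p \<noteq> {}" by blast
    fix \<sigma> assume \<sigma>: "\<sigma> \<in> null_sequences p"
    then have "\<ominus>\<^bsub>cauchy_ring p\<^esub> \<sigma> = (\<lambda>n. - \<sigma> n)"
      using null_sequence_cauchy[OF \<sigma>]
      by (intro R.minus_equality) (auto simp: cauchy_ring_simps cauchy_minus)
    then show "\<ominus>\<^bsub>cauchy_ring p\<^esub> \<sigma> \<in> null_sequences p"
      using \<sigma> by (simp add: null_sequences_def)
    fix \<tau> assume \<tau>: "\<tau> \<in> null_sequences p"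
    have "(\<lambda>n. p (\<sigma> n + \<tau> n)) \<longlonglongrightarrow> 0"
      using \<sigma> \<tau> tendsto_add[of "\<lambda>n. p (\<sigma> n)" 0 sequentially "\<lambda>n. p (\<tau> n)" 0]
      by (intro tendsto_sandwich[of "\<lambda>_. 0" "\<lambda>n. p (\<sigma> n + \<tau> n)" sequentially "\<lambda>n. p (\<sigma> n) + p (\<tau> n)"])
        (auto simp: null_sequences_def nonneg triangle)
    then show "\<sigma> \<oplus>\<^bsub>cauchy_ring p\<^esub> \<tau> \<in> null_sequences p"
      by (simp add: null_sequences_def cauchy_ring_simps)
  qed
next
  fix \<sigma> \<tau> assume \<sigma>: "\<sigma> \<in> null_sequences p" and \<tau>: "\<tau> \<in> carrier (cauchy_ring p)"
  obtain B where B: "0 \<le> B" "\<And>n. p (\<tau> n) \<le> B" using cauchy_bounded[OF \<tau>] by blast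
  have lim: "(\<lambda>n. B * p (\<sigma> n)) \<longlonglongrightarrow> 0"
    using \<sigma> tendsto_mult_right_zero by (auto simp: null_sequences_def)
  have "p (\<tau> n * \<sigma> n) \<le> B * p (\<sigma> n)" "p (\<sigma> n * \<tau> n) \<le> B * p (\<sigma> n)" for n
    using submultiplicative[of "\<tau> n" "\<sigma> n"] submultiplicative[of "\<sigma> n" "\<tau> n"]
      mult_right_mono[OF B(2) nonneg, of n "\<sigma> n"] by (auto simp: mult.commute)
  then have "(\<lambda>n. p (\<tau> n * \<sigma> n)) \<longlonglongrightarrow> 0" "(\<lambda>n. p (\<sigma> n * \<tau> n)) \<longlonglongrightarrow> 0"
    using tendsto_sandwich[OF _ _ tendsto_const lim] by (auto simp: nonneg)
  then show "\<tau> \<otimes>\<^bsub>cauchy_ring p\<^esub> \<sigma> \<in> null_sequences p" "\<sigma> \<otimes>\<^bsub>cauchy_ring p\<^esub> \<tau> \<in> null_sequences p"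
    by (simp_all add: null_sequences_def cauchy_ring_simps)
qed

end

locale commutative_algebra_norm = algebra_norm smul p
  for smul :: "complex \<Rightarrow> 'a::ring_1 \<Rightarrow> 'a" and p +
  assumes norm_mult_commute: "(x :: 'a) * y = y * x"

sublocale commutative_algebra_norm \<subseteq> commutative_algebra_seminorm smul p
  by unfold_locales (rule norm_mult_commute)

section \<open>Elementary properties of characters\<close>

lemma character_one:
  assumes "f \<in> characters smul"
  shows "f 1 = 1"
proof -
  obtain x where "f x \<noteq> 0" using assms by (auto simp: characters_def)
  moreover have "f (1 * x) = f 1 * f x" using assms unfolding characters_def by blast
  ultimately show ?thesis by simp
qed

lemma character_diff:
  assumes "f \<in> characters smul"
  shows "f (x - y) = f x - f y"
proof -
  interpret Vector_Spaces.linear smul "(*)" f using assms by (simp add: characters_def)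
  show ?thesis by (rule diff)
qed

lemma character_scale:
  assumes "f \<in> characters smul"
  shows "f (smul c x) = c * f x"
proof -
  interpret Vector_Spaces.linear smul "(*)" f using assms by (simp add: characters_def)
  show ?thesis by (rule scale)
qed

lemma character_mult:
  assumes "f \<in> characters smul"
  shows "f (x * y) = f x * f y"
  using assms by (simp add: characters_def)

lemma character_power:
  assumes "f \<in> characters smul"
  shows "f (x ^ n) = f x ^ n"
  by (induction n) (simp_all add: character_one[OF assms] character_mult[OF assms])

section \<open>Characters from maximal left ideals of the completion\<close>

context commutative_algebra_norm
begin

text \<open>The Neumann series: if \<^term>\<open>\<sigma> n\<close> stays within distance less than 1 of the unit, then
  its approximate inverses \<^term>\<open>\<tau> n\<close> satisfy
  \<^term>\<open>\<tau> m - \<tau> n = \<tau> m * (1 - \<tau> n * \<sigma> n) - \<tau> n * (1 - \<tau> m * \<sigma> m) + \<tau> m * \<tau> n * (\<sigma> n - \<sigma> m)\<close>,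
  so they form a Cauchy sequence.\<close>

lemma cauchy_near_one_invertible:
  assumes \<sigma>: "\<sigma> \<in> carrier (cauchy_ring p)" and "c < 1"
    and near: "\<forall>\<^sub>F n in sequentially. p (1 - \<sigma> n) \<le> c"
  obtains \<tau> where "\<tau> \<in> carrier (cauchy_ring p)" "(\<lambda>n. 1 - \<tau> n * \<sigma> n) \<in> null_sequences p"
proof
  obtain N where N: "\<And>n. N \<le> n \<Longrightarrow> p (1 - \<sigma> n) \<le> c"
    using near by (auto simp: eventually_sequentially)
  have c: "0 \<le> c" using N[of N] nonneg[of "1 - \<sigma> N"] by linarith
  \<comment> \<open>The Neumann series for the inverse of \<open>\<sigma> n\<close>, cut off after
    \<open>n\<close> terms: the cut-off grows with the index, so the remainder
    \<open>(1 - \<sigma> n) ^ n\<close> tends to 0 along the sequence.\<close>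
  define \<tau> where "\<tau> n = (\<Sum>k<n. (1 - \<sigma> n) ^ k)" for n
  define M where "M = p 1 / (1 - c)"
  have power_le: "p ((1 - \<sigma> n) ^ k) \<le> c ^ k * p 1" if "N \<le> n" for n k
    using seminorm_power_mult[of "1 - \<sigma> n" k 1] power_mono[OF N[OF that] nonneg, of k]
      mult_right_mono[OF _ nonneg, of _ "c ^ k" 1] by force
  have inverse: "1 - \<tau> n * \<sigma> n = (1 - \<sigma> n) ^ n" for n
  proof -
    have "(\<Sum>k<m. x ^ k) * (1 - x) = 1 - x ^ m" for m and x :: 'a
    proof (induction m)
      case (Suc m)
      have "(\<Sum>k<Suc m. x ^ k) * (1 - x) = (1 - x ^ m) + (x ^ m - x ^ Suc m)"
        unfolding Suc[symmetric] sum.lessThan_Suc distrib_right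
        by (simp add: right_diff_distrib power_commutes)
      then show ?case by simp
    qed simp
    from this[where m = n and x = "1 - \<sigma> n"] show ?thesis by (simp add: \<tau>_def)
  qed
  have inverse_le: "p (1 - \<tau> n * \<sigma> n) \<le> c ^ n * p 1" if "N \<le> n" for n
    unfolding inverse by (rule power_le[OF that])
  have \<tau>_le: "p (\<tau> n) \<le> M" if "N \<le> n" for n
  proof -
    have "p (\<tau> n) \<le> (\<Sum>k<n. c ^ k * p 1)"
      unfolding \<tau>_def by (intro order.trans[OF seminorm_sum] sum_mono power_le that)
    also have "\<dots> = (1 - c ^ n) / (1 - c) * p 1"
      using \<open>c < 1\<close> by (simp add: sum_distrib_right[symmetric] sum_gp_strict)
    also have "\<dots> \<le> 1 / (1 - c) * p 1"
      using \<open>c < 1\<close> c by (intro mult_right_mono divide_right_mono) (auto simp: nonneg)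
    finally show ?thesis by (simp add: M_def)
  qed
  have M: "0 \<le> M" using \<open>c < 1\<close> by (simp add: M_def nonneg)
  have lim: "(\<lambda>n. c ^ n * p 1) \<longlonglongrightarrow> 0"
    using c \<open>c < 1\<close> by (intro tendsto_mult_left_zero LIMSEQ_realpow_zero)
  show "(\<lambda>n. 1 - \<tau> n * \<sigma> n) \<in> null_sequences p"
    unfolding null_sequences_def mem_Collect_eq
    using inverse_le
    by (intro tendsto_sandwich[OF _ _ tendsto_const lim])
      (auto simp: eventually_sequentially nonneg intro: exI[of _ N])
  show "\<tau> \<in> carrier (cauchy_ring p)"
  proof (rule cauchy_ring_carrierI[OF _ _ \<sigma>])
    show "(\<lambda>n. M * (c ^ n * p 1)) \<longlonglongrightarrow> 0" using lim by (rule tendsto_mult_right_zero)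
    fix m n assume mn: "N \<le> m" "N \<le> n"
    have "\<tau> m * (\<tau> n * \<sigma> m) = \<tau> n * (\<tau> m * \<sigma> m)" "\<tau> m * (\<tau> n * \<sigma> n) = \<tau> m * \<tau> n * \<sigma> n"
      by (metis mult.assoc mult_commute)+
    then have "\<tau> m - \<tau> n = (\<tau> m * (1 - \<tau> n * \<sigma> n) - \<tau> n * (1 - \<tau> m * \<sigma> m)) + \<tau> m * \<tau> n * (\<sigma> n - \<sigma> m)"
      by (simp add: algebra_simps)
    then have "p (\<tau> m - \<tau> n) \<le> (p (\<tau> m) * p (1 - \<tau> n * \<sigma> n) + p (\<tau> n) * p (1 - \<tau> m * \<sigma> m))
        + p (\<tau> m) * p (\<tau> n) * p (\<sigma> n - \<sigma> m)"
      using triangle[of "\<tau> m * (1 - \<tau> n * \<sigma> n) - \<tau> n * (1 - \<tau> m * \<sigma> m)" "\<tau> m * \<tau> n * (\<sigma> n - \<sigma> m)"]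
        seminorm_diff[of "\<tau> m * (1 - \<tau> n * \<sigma> n)" "\<tau> n * (1 - \<tau> m * \<sigma> m)"]
        submultiplicative[of "\<tau> m" "1 - \<tau> n * \<sigma> n"] submultiplicative[of "\<tau> n" "1 - \<tau> m * \<sigma> m"]
        submultiplicative[of "\<tau> m * \<tau> n" "\<sigma> n - \<sigma> m"]
        mult_right_mono[OF submultiplicative[of "\<tau> m" "\<tau> n"] nonneg, of "\<sigma> n - \<sigma> m"]
      by simp
    also have "\<dots> \<le> (M * (c ^ n * p 1) + M * (c ^ m * p 1)) + M * M * p (\<sigma> n - \<sigma> m)"
      using mn M by (intro add_mono mult_mono \<tau>_le inverse_le) (auto simp: nonneg)
    finally show "p (\<tau> m - \<tau> n) \<le> M * (c ^ m * p 1) + M * (c ^ n * p 1) + M * M * p (\<sigma> m - \<sigma> n)"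
      by (simp add: seminorm_minus_commute[of "\<sigma> n"])
  qed
qed

text \<open>The distance from the constant sequence \<^term>\<open>y\<close> to an ideal \<^term>\<open>J\<close> of Cauchy sequences:
  the quotient norm of the completion by the closure of \<^term>\<open>J\<close>, restricted to the algebra.\<close>

definition ideal_bounds :: "(nat \<Rightarrow> 'a) set \<Rightarrow> 'a \<Rightarrow> real set"
  where "ideal_bounds J y = {c. \<exists>\<sigma>\<in>J. \<forall>\<^sub>F n in sequentially. p (y - \<sigma> n) \<le> c}"

definition ideal_dist :: "(nat \<Rightarrow> 'a) set \<Rightarrow> 'a \<Rightarrow> real"
  where "ideal_dist J y = Inf (ideal_bounds J y)"

lemma ideal_bounds_nonneg: "c \<in> ideal_bounds J y \<Longrightarrow> 0 \<le> c"
  unfolding ideal_bounds_def eventually_sequentially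
  using nonneg order.trans by blast

lemma ideal_dist_le: "c \<in> ideal_bounds J y \<Longrightarrow> ideal_dist J y \<le> c"
  unfolding ideal_dist_def by (intro cInf_lower bdd_belowI[of _ 0] ideal_bounds_nonneg)

text \<open>The distance to \<open>J\<close> is an algebra seminorm below \<open>p\<close>. It is at
  least 1 at the unit, because an ideal element closer to 1 would have an inverse modulo null
  sequences and so put the unit into \<open>J\<close>. This is what
  \<open>character_exists_below\<close> asks for.\<close>

lemma ideal_dist_character:
  assumes J: "J \<subseteq> carrier (cauchy_ring p)" and zero: "(\<lambda>_. 0) \<in> J"
    and add: "\<And>\<sigma> \<tau>. \<sigma> \<in> J \<Longrightarrow> \<tau> \<in> J \<Longrightarrow> (\<lambda>n. \<sigma> n + \<tau> n) \<in> J"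
    and mult: "\<And>\<sigma> \<tau>. \<sigma> \<in> carrier (cauchy_ring p) \<Longrightarrow> \<tau> \<in> J \<Longrightarrow> (\<lambda>n. \<sigma> n * \<tau> n) \<in> J"
    and null: "null_sequences p \<subseteq> J" and one: "(\<lambda>_. 1) \<notin> J"
  obtains f where "f \<in> characters smul" "\<And>x. cmod (f x) \<le> ideal_dist J x" "\<And>x. cmod (f x) \<le> p x"
proof -
  have mem: "p y \<in> ideal_bounds J y" for y
    using zero unfolding ideal_bounds_def by (intro CollectI bexI[of _ "\<lambda>_. 0"]) auto
  have nonneg_dist: "0 \<le> ideal_dist J y" for y
    unfolding ideal_dist_def using mem ideal_bounds_nonneg by (intro cInf_greatest) blast+
  have approx: "\<exists>c\<in>ideal_bounds J y. c < ideal_dist J y + e" if "0 < e" for y e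
    using mem[of y] that cInf_lessD[of "ideal_bounds J y" "ideal_dist J y + e"]
    by (auto simp: ideal_dist_def)
  have scale: "(\<lambda>n. smul k (\<sigma> n)) \<in> J" if "\<sigma> \<in> J" for k \<sigma>
    using mult[OF cauchy_const that, of "smul k 1"] by (simp add: smul_mult_left)
  have "commutative_algebra_seminorm smul (ideal_dist J)"
  proof (rule commutative_algebra_seminormI)
    fix x y k
    have "ideal_dist J (x + y) \<le> (ideal_dist J x + e) + (ideal_dist J y + e)" if e: "0 < e" for e
    proof -
      obtain c \<sigma> where c: "c < ideal_dist J x + e" "\<sigma> \<in> J" "\<forall>\<^sub>F n in sequentially. p (x - \<sigma> n) \<le> c"
        using approx[OF e, of x] by (auto simp: ideal_bounds_def)
      obtain d \<tau> where d: "d < ideal_dist J y + e" "\<tau> \<in> J" "\<forall>\<^sub>F n in sequentially. p (y - \<tau> n) \<le> d"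
        using approx[OF e, of y] by (auto simp: ideal_bounds_def)
      have "\<forall>\<^sub>F n in sequentially. p (x + y - (\<sigma> n + \<tau> n)) \<le> c + d"
        using c(3) d(3)
      proof eventually_elim
        case (elim n)
        then show ?case using triangle[of "x - \<sigma> n" "y - \<tau> n"] by (simp add: algebra_simps)
      qed
      then have "c + d \<in> ideal_bounds J (x + y)"
        using add[OF c(2) d(2)] by (auto simp: ideal_bounds_def)
      then show ?thesis using ideal_dist_le c d by fastforce
    qed
    then have "ideal_dist J (x + y) \<le> (ideal_dist J x + 0) + (ideal_dist J y + 0)"
      by (intro le_at_zeroI[of "\<lambda>e. (ideal_dist J x + e) + (ideal_dist J y + e)"] continuous_intros)
    then show "ideal_dist J (x + y) \<le> ideal_dist J x + ideal_dist J y" by simp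
    have "ideal_dist J (x * y) \<le> (ideal_dist J x + e) * (ideal_dist J y + e)" if e: "0 < e" for e
    proof -
      obtain c \<sigma> where c: "c < ideal_dist J x + e" "\<sigma> \<in> J" "\<forall>\<^sub>F n in sequentially. p (x - \<sigma> n) \<le> c"
          "0 \<le> c"
        using approx[OF e, of x] ideal_bounds_nonneg[of _ J x] by (auto simp: ideal_bounds_def)
      obtain d \<tau> where d: "d < ideal_dist J y + e" "\<tau> \<in> J" "\<forall>\<^sub>F n in sequentially. p (y - \<tau> n) \<le> d"
          "0 \<le> d"
        using approx[OF e, of y] ideal_bounds_nonneg[of _ J y] by (auto simp: ideal_bounds_def)
      \<comment> \<open>Chosen so that \<open>x * y - \<upsilon> n\<close> factors as
        \<open>(x - \<sigma> n) * (y - \<tau> n)\<close>; each summand has a factor from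
        \<open>J\<close>.\<close>
      define \<upsilon> where "\<upsilon> n = (x * \<tau> n + y * \<sigma> n) + smul (- 1) (\<sigma> n * \<tau> n)" for n
      have "\<upsilon> \<in> J"
        unfolding \<upsilon>_def using c(2) d(2) J by (intro add scale mult cauchy_const) auto
      moreover have "\<forall>\<^sub>F n in sequentially. p (x * y - \<upsilon> n) \<le> c * d"
        using c(3) d(3)
      proof eventually_elim
        case (elim n)
        have "x * y - \<upsilon> n = (x - \<sigma> n) * (y - \<tau> n)"
          by (simp add: \<upsilon>_def algebra_simps mult_commute[of y "\<sigma> n"])
        then have "p (x * y - \<upsilon> n) \<le> p (x - \<sigma> n) * p (y - \<tau> n)"
          by (simp add: submultiplicative)
        also have "\<dots> \<le> c * d" using elim c(4) by (intro mult_mono) (auto simp: nonneg)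
        finally show ?case .
      qed
      ultimately have "ideal_dist J (x * y) \<le> c * d"
        by (intro ideal_dist_le) (auto simp: ideal_bounds_def)
      also have "\<dots> \<le> (ideal_dist J x + e) * (ideal_dist J y + e)"
        using c d by (intro mult_mono) auto
      finally show ?thesis .
    qed
    then have "ideal_dist J (x * y) \<le> (ideal_dist J x + 0) * (ideal_dist J y + 0)"
      by (intro le_at_zeroI[of "\<lambda>e. (ideal_dist J x + e) * (ideal_dist J y + e)"] continuous_intros)
    then show "ideal_dist J (x * y) \<le> ideal_dist J x * ideal_dist J y" by simp
    have le: "ideal_dist J (smul k x) \<le> cmod k * ideal_dist J x" for k x
    proof -
      have "ideal_dist J (smul k x) \<le> cmod k * (ideal_dist J x + e)" if e: "0 < e" for e
      proof -
        obtain c \<sigma> where c: "c < ideal_dist J x + e" "\<sigma> \<in> J" "\<forall>\<^sub>F n in sequentially. p (x - \<sigma> n) \<le> c"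
          using approx[OF e, of x] by (auto simp: ideal_bounds_def)
        have "\<forall>\<^sub>F n in sequentially. p (smul k x - smul k (\<sigma> n)) \<le> cmod k * c"
          using c(3)
          by eventually_elim (simp add: homogeneous mult_left_mono flip: scale_right_diff_distrib)
        then have "ideal_dist J (smul k x) \<le> cmod k * c"
          using scale[OF c(2)] by (intro ideal_dist_le) (auto simp: ideal_bounds_def)
        also have "\<dots> \<le> cmod k * (ideal_dist J x + e)" using c by (intro mult_left_mono) auto
        finally show ?thesis .
      qed
      then have "ideal_dist J (smul k x) \<le> cmod k * (ideal_dist J x + 0)"
        by (intro le_at_zeroI[of "\<lambda>e. cmod k * (ideal_dist J x + e)"] continuous_intros)
      then show ?thesis by simp
    qed
    show "ideal_dist J (smul k x) = cmod k * ideal_dist J x"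
    proof (cases "k = 0")
      case True
      then show ?thesis using le[of k x] nonneg_dist[of "smul k x"] by simp
    next
      case False
      then have "ideal_dist J x \<le> cmod (inverse k) * ideal_dist J (smul k x)"
        using le[of "inverse k" "smul k x"] by simp
      then have "cmod k * ideal_dist J x \<le> ideal_dist J (smul k x)"
        using False by (simp add: norm_divide field_simps)
      with le show ?thesis by (intro antisym)
    qed
  qed
  then interpret d: commutative_algebra_seminorm smul "ideal_dist J" .
  have "1 \<le> c" if c: "c \<in> ideal_bounds J 1" for c
  proof (rule ccontr)
    assume "\<not> 1 \<le> c"
    moreover obtain \<sigma> where \<sigma>: "\<sigma> \<in> J" "\<forall>\<^sub>F n in sequentially. p (1 - \<sigma> n) \<le> c"
      using c by (auto simp: ideal_bounds_def)
    ultimately obtain \<tau> where \<tau>: "\<tau> \<in> carrier (cauchy_ring p)" "(\<lambda>n. 1 - \<tau> n * \<sigma> n) \<in> null_sequences p"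
      using cauchy_near_one_invertible[of \<sigma> c] J by (metis not_le subsetD)
    then have "(\<lambda>n. (1 - \<tau> n * \<sigma> n) + \<tau> n * \<sigma> n) \<in> J"
      using null \<sigma> by (intro add mult) auto
    then show False using one by simp
  qed
  then have "1 \<le> ideal_dist J 1"
    unfolding ideal_dist_def using mem by (intro cInf_greatest) blast+
  then obtain f where f: "f \<in> characters smul" "\<And>x. cmod (f x) \<le> ideal_dist J x"
    using d.character_exists_below by blast
  then show ?thesis
    using that ideal_dist_le[OF mem] by (meson order.trans)
qed

text \<open>Let \<open>J\<close> be the preimage of \<open>I\<close> and \<open>f\<close> a
  character below the distance to \<open>J\<close>. By maximality the class of \<open>x\<close> has
  a left inverse modulo \<open>I\<close>. Since \<open>f\<close> is defined only on the algebra, a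
  late term \<open>\<tau> k\<close> of a representing sequence replaces this inverse:
  \<open>\<tau> k * x - 1\<close> is so close to \<open>J\<close> that \<open>f\<close> cannot
  vanish at \<open>x\<close>.\<close>

lemma maximal_left_ideal_character:
  assumes I: "maximal_left_ideal I (completion p)"
    and x: "null_sequences p +>\<^bsub>cauchy_ring p\<^esub> (\<lambda>_. x) \<notin> I"
  obtains f where "f \<in> characters smul" "\<And>y. cmod (f y) \<le> p y" "f x \<noteq> 0"
proof -
  interpret N: ideal "null_sequences p" "cauchy_ring p" by (rule null_sequences_ideal)
  define \<pi> where "\<pi> \<sigma> = null_sequences p +>\<^bsub>cauchy_ring p\<^esub> \<sigma>" for \<sigma>
  interpret B: ring "completion p" unfolding completion_def by (rule N.quotient_is_ring)
  have hom: "\<pi> \<in> ring_hom (cauchy_ring p) (completion p)"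
    using N.rcos_ring_hom unfolding completion_def \<pi>_def by simp
  have left: "left_ideal I (completion p)" "I \<noteq> carrier (completion p)"
    using I by (auto simp: maximal_left_ideal_def)
  interpret I: additive_subgroup I "completion p" using left by (simp add: left_ideal_def)
  have I_mult: "r \<otimes>\<^bsub>completion p\<^esub> i \<in> I" if "r \<in> carrier (completion p)" "i \<in> I" for r i
    using left that by (simp add: left_ideal_def)
  have surj: "\<exists>\<sigma>\<in>carrier (cauchy_ring p). b = \<pi> \<sigma>" if "b \<in> carrier (completion p)" for b
    using that by (auto simp: completion_def FactRing_def A_RCOSETS_def' \<pi>_def)
  have null_iff: "\<pi> \<sigma> = \<zero>\<^bsub>completion p\<^esub>" if "\<sigma> \<in> null_sequences p" for \<sigma>
    using N.a_rcos_const[OF that] by (simp add: completion_def FactRing_def \<pi>_def)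
  define J where "J = {\<sigma> \<in> carrier (cauchy_ring p). \<pi> \<sigma> \<in> I}"
  have J_add: "(\<lambda>n. \<sigma> n + \<tau> n) \<in> J" if "\<sigma> \<in> J" "\<tau> \<in> J" for \<sigma> \<tau>
    using that ring_hom_add[OF hom, of \<sigma> \<tau>] I.a_closed
    by (auto simp: J_def cauchy_ring_simps cauchy_add)
  have J_mult: "(\<lambda>n. \<sigma> n * \<tau> n) \<in> J" if "\<sigma> \<in> carrier (cauchy_ring p)" "\<tau> \<in> J" for \<sigma> \<tau>
    using that ring_hom_mult[OF hom, of \<sigma> \<tau>] I_mult[OF ring_hom_closed[OF hom, of \<sigma>]]
    by (auto simp: J_def cauchy_ring_simps cauchy_mult)
  have J_null: "null_sequences p \<subseteq> J"
    using null_sequence_cauchy null_iff I.zero_closed by (auto simp: J_def)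
  have "\<one>\<^bsub>completion p\<^esub> \<notin> I"
  proof
    assume one: "\<one>\<^bsub>completion p\<^esub> \<in> I"
    have "carrier (completion p) \<subseteq> I" using I_mult[OF _ one] by auto
    then show False using left I.a_subset by blast
  qed
  then have J_one: "(\<lambda>_. 1) \<notin> J"
    using ring_hom_one[OF hom] by (simp add: J_def cauchy_ring_simps)
  have "(\<lambda>_. 0) \<in> null_sequences p" by (simp add: null_sequences_def)
  then obtain f where f: "f \<in> characters smul" "\<And>x. cmod (f x) \<le> ideal_dist J x" "\<And>x. cmod (f x) \<le> p x"
    using ideal_dist_character[of J, OF _ _ J_add J_mult J_null J_one] J_null J_def by blast
  have "\<pi> (\<lambda>_. x) \<in> carrier (completion p)" by (rule ring_hom_closed[OF hom cauchy_const])
  then obtain a i where ai: "a \<in> carrier (completion p)" "i \<in> I"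
    "a \<otimes>\<^bsub>completion p\<^esub> \<pi> (\<lambda>_. x) \<oplus>\<^bsub>completion p\<^esub> i = \<one>\<^bsub>completion p\<^esub>"
    using B.maximal_left_ideal_comaximal[OF I] x unfolding \<pi>_def by metis
  obtain \<tau> where \<tau>: "\<tau> \<in> carrier (cauchy_ring p)" "a = \<pi> \<tau>" using surj[OF ai(1)] by blast
  define \<rho> where "\<rho> = (\<lambda>n. \<tau> n * x - 1)"
  have \<rho>: "\<rho> \<in> carrier (cauchy_ring p)"
    using cauchy_add[OF cauchy_mult[OF \<tau>(1) cauchy_const] cauchy_const, of x "- 1"]
    by (simp add: \<rho>_def)
  have "\<pi> (\<lambda>n. \<tau> n * x) = \<pi> \<rho> \<oplus>\<^bsub>completion p\<^esub> \<one>\<^bsub>completion p\<^esub>"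
    using ring_hom_add[OF hom \<rho> cauchy_const, of 1] ring_hom_one[OF hom]
    by (simp add: cauchy_ring_simps \<rho>_def)
  moreover have "\<pi> (\<lambda>n. \<tau> n * x) = a \<otimes>\<^bsub>completion p\<^esub> \<pi> (\<lambda>_. x)"
    using ring_hom_mult[OF hom \<tau>(1) cauchy_const, of x] \<tau>(2) by (simp add: cauchy_ring_simps)
  ultimately have "\<pi> \<rho> \<oplus>\<^bsub>completion p\<^esub> \<one>\<^bsub>completion p\<^esub> \<oplus>\<^bsub>completion p\<^esub> i = \<one>\<^bsub>completion p\<^esub>"
    using ai(3) by simp
  moreover have carr: "\<pi> \<rho> \<in> carrier (completion p)" "i \<in> carrier (completion p)"
    using ring_hom_closed[OF hom \<rho>] ai(2) I.a_subset by auto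
  ultimately have "\<one>\<^bsub>completion p\<^esub> \<oplus>\<^bsub>completion p\<^esub> (\<pi> \<rho> \<oplus>\<^bsub>completion p\<^esub> i) = \<one>\<^bsub>completion p\<^esub>"
    by (simp add: B.a_ac)
  then have "\<pi> \<rho> \<oplus>\<^bsub>completion p\<^esub> i = \<zero>\<^bsub>completion p\<^esub>"
    using carr by (metis B.add.l_cancel_one B.a_closed B.one_closed)
  then have "\<pi> \<rho> = \<ominus>\<^bsub>completion p\<^esub> i" using carr by (simp add: B.minus_equality)
  then have "\<rho> \<in> J" using \<rho> I.a_inv_closed[OF ai(2)] B.abelian_group_axioms by (simp add: J_def)
  \<comment> \<open>Makes the error of replacing \<open>\<tau> n\<close> by \<open>\<tau> k\<close>
    at most \<open>1 / 2\<close> after multiplication by \<open>x\<close>; what matters is that this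
    is less than 1, the modulus of \<open>f 1\<close>.\<close>
  define e where "e = 1 / (2 * (p x + 1))"
  have e: "0 < e" "e * p x \<le> 1 / 2"
    using nonneg[of x] unfolding e_def by (simp_all add: add_nonneg_pos pos_divide_le_eq)
  obtain k where k: "\<And>n. k \<le> n \<Longrightarrow> p (\<tau> k - \<tau> n) < e"
    using \<tau>(1) e(1) unfolding cauchy_ring_carrier_iff by (metis order_refl)
  have "p (\<tau> k * x - 1 - \<rho> n) \<le> 1 / 2" if "k \<le> n" for n
  proof -
    have "\<tau> k * x - 1 - \<rho> n = (\<tau> k - \<tau> n) * x" by (simp add: \<rho>_def algebra_simps)
    then have "p (\<tau> k * x - 1 - \<rho> n) \<le> p (\<tau> k - \<tau> n) * p x" by (simp add: submultiplicative)
    also have "\<dots> \<le> e * p x" using k[OF that] by (intro mult_right_mono) (auto simp: nonneg)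
    finally show ?thesis using e(2) by simp
  qed
  then have "1 / 2 \<in> ideal_bounds J (\<tau> k * x - 1)"
    using \<open>\<rho> \<in> J\<close> unfolding ideal_bounds_def eventually_sequentially by blast
  then have "cmod (f (\<tau> k * x - 1)) \<le> 1 / 2" using f(2) ideal_dist_le order.trans by blast
  then have "f x \<noteq> 0"
    by (auto simp: character_diff[OF f(1)] character_mult[OF f(1)] character_one[OF f(1)])
  then show ?thesis using that f by blast
qed

text \<open>A nonzero constant sequence is not null, so semisimplicity places its class outside some
  maximal left ideal.\<close>

lemma semisimple_character_exists:
  assumes "semisimple_norm p" "x \<noteq> 0"
  obtains f where "f \<in> characters smul" "\<And>y. cmod (f y) \<le> p y" "f x \<noteq> 0"
proof -
  interpret N: ideal "null_sequences p" "cauchy_ring p" by (rule null_sequences_ideal)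
  define X where "X = null_sequences p +>\<^bsub>cauchy_ring p\<^esub> (\<lambda>_. x)"
  have "(\<lambda>_. x) \<notin> null_sequences p"
    using \<open>x \<noteq> 0\<close> by (simp add: null_sequences_def LIMSEQ_const_iff eq_zero_iff)
  then have "X \<noteq> \<zero>\<^bsub>completion p\<^esub>"
    using N.a_coset_join1[OF _ cauchy_const N.a_subgroup, of x]
    by (auto simp: X_def completion_def FactRing_def)
  then have "X \<notin> jacobson_radical (completion p)" using assms by (simp add: semisimple_norm_def)
  moreover have "X \<in> carrier (completion p)"
    using ring_hom_closed[OF N.rcos_ring_hom cauchy_const] by (simp add: X_def completion_def)
  ultimately obtain I where "maximal_left_ideal I (completion p)" "X \<notin> I"
    by (auto simp: jacobson_radical_def)
  then show ?thesis
    using maximal_left_ideal_character that unfolding X_def by metis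
qed

end

section \<open>Continuity for the norm topology\<close>

context algebra_norm
begin

lemma openin_norm_topology:
  "openin (norm_topology p) U \<longleftrightarrow> (\<forall>x\<in>U. \<exists>r>0. \<forall>y. p (x - y) < r \<longrightarrow> y \<in> U)"
  unfolding norm_topology_def Metric_space.openin_mtopology[OF Metric_space_norm_dist]
    Metric_space.mball_def[OF Metric_space_norm_dist] norm_dist_def
  by (auto simp: subset_iff)

lemma topspace_norm_topology [simp]: "topspace (norm_topology p) = UNIV"
  by (simp add: norm_topology_def Metric_space.topspace_mtopology[OF Metric_space_norm_dist])

lemma continuous_map_imp_bound_at_zero:
  fixes g :: "'a \<Rightarrow> 'b::real_normed_vector"
  assumes "continuous_map (norm_topology p) euclidean g" "g 0 = 0"
  obtains r where "0 < r" "\<And>x. p x < r \<Longrightarrow> norm (g x) < 1"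
proof -
  have "openin (norm_topology p) {x. g x \<in> ball 0 1}"
    using openin_continuous_map_preimage[OF assms(1), of "ball 0 1"] by simp
  moreover have "0 \<in> {x. g x \<in> ball 0 1}" using assms(2) by simp
  ultimately obtain r where "0 < r" "\<And>y. p (0 - y) < r \<Longrightarrow> y \<in> {x. g x \<in> ball 0 1}"
    unfolding openin_norm_topology by meson
  then show ?thesis using that by simp
qed

text \<open>If \<open>cmod (f x) > p x\<close>, rescaling gives \<open>f y = 1\<close> with
  \<open>p y < 1\<close>; the powers of \<open>y\<close> then tend to 0 while \<open>f\<close> stays
  1 on them, against continuity at 0.\<close>

lemma continuous_characters_iff:
  "f \<in> continuous_characters smul p \<longleftrightarrow> f \<in> characters smul \<and> (\<forall>x. cmod (f x) \<le> p x)"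
proof (intro iffI conjI allI)
  assume f: "f \<in> continuous_characters smul p"
  then show char: "f \<in> characters smul" by (simp add: continuous_characters_def)
  have "f 0 = 0" using character_diff[OF char, of 0 0] by simp
  then obtain r where r: "0 < r" "\<And>x. p x < r \<Longrightarrow> cmod (f x) < 1"
    using f continuous_map_imp_bound_at_zero[of f] by (auto simp: continuous_characters_def)
  show "cmod (f x) \<le> p x" for x
  proof (rule ccontr)
    assume "\<not> cmod (f x) \<le> p x"
    then have less: "p x < cmod (f x)" by simp
    then have nz: "f x \<noteq> 0" using nonneg[of x] by (metis norm_zero not_le)
    define y where "y = smul (inverse (f x)) x"
    have y: "f y = 1" using nz by (simp add: y_def character_scale[OF char])
    have "p y < 1" using less nz by (simp add: y_def homogeneous norm_divide field_simps)
    then have "(\<lambda>n. p y ^ Suc n) \<longlonglongrightarrow> 0"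
      by (intro LIMSEQ_Suc LIMSEQ_realpow_zero nonneg)
    then obtain n where "p y ^ Suc n < r"
      using order_tendstoD(2)[OF _ r(1)] by (metis eventually_sequentially order_refl)
    then have "cmod (f (y ^ Suc n)) < 1"
      using seminorm_power_Suc[of y n] by (intro r(2)) simp
    then show False by (simp only: character_power[OF char] y) simp
  qed
next
  assume f: "f \<in> characters smul \<and> (\<forall>x. cmod (f x) \<le> p x)"
  have "openin (norm_topology p) {x. f x \<in> U}" if "open U" for U
    unfolding openin_norm_topology
  proof
    fix x assume "x \<in> {x. f x \<in> U}"
    then obtain r where r: "0 < r" "\<And>z. dist z (f x) < r \<Longrightarrow> z \<in> U"
      using \<open>open U\<close> unfolding open_dist by blast
    have "f y \<in> U" if "p (x - y) < r" for y
    proof (rule r(2))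
      have "dist (f y) (f x) = cmod (f (x - y))"
        using f by (simp add: character_diff[of f smul] dist_norm norm_minus_commute)
      then show "dist (f y) (f x) < r" using f that by (metis le_less_trans)
    qed
    then show "\<exists>r>0. \<forall>y. p (x - y) < r \<longrightarrow> y \<in> {x. f x \<in> U}" using r(1) by auto
  qed
  then show "f \<in> continuous_characters smul p"
    using f by (simp add: continuous_characters_def continuous_map_def)
qed

lemma continuous_norm_bound:
  assumes q: "algebra_norm smul q" and cont: "continuous_map (norm_topology p) euclideanreal q"
  obtains C where "0 < C" "\<And>x. q x \<le> C * p x"
proof -
  interpret q: algebra_norm smul q by (rule q)
  obtain r where r: "0 < r" "\<And>x. p x < r \<Longrightarrow> norm (q x) < 1"
    using continuous_map_imp_bound_at_zero[OF cont] by auto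
  have "q x \<le> 2 / r * p x" for x
  proof (cases "x = 0")
    case False
    then have pos: "0 < p x" using eq_zero_iff nonneg[of x] by (simp add: less_le)
    \<comment> \<open>Scales \<open>x\<close> to norm \<open>r / 2\<close>, safely inside the ball
      where \<open>q\<close> is below 1.\<close>
    define c where "c = r / (2 * p x)"
    have c: "0 < c" using r pos by (simp add: c_def)
    have "p (smul (of_real c) x) < r"
      using r pos c by (simp add: homogeneous) (simp add: c_def)
    then have "c * q x < 1"
      using r(2)[of "smul (of_real c) x"] c by (simp add: q.homogeneous q.nonneg)
    then show ?thesis using r pos by (simp add: c_def field_simps)
  qed simp
  with r that[of "2 / r"] show ?thesis by simp
qed

end

section \<open>Weak regularity and comparison of norms\<close>

text \<open>Each inequality involves a single evaluation, which is continuous for pointwise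
  convergence.\<close>

lemma closedin_dominated_characters:
  "closedin (gelfand_topology smul p) {f \<in> continuous_characters smul p. \<forall>x. cmod (f x) \<le> q x}"
proof -
  have "closed {f :: 'a::ring_1 \<Rightarrow> complex. \<forall>x. cmod (f x) \<le> q x}"
    by (intro closed_Collect_all closed_Collect_le continuous_intros) auto
  then have "closedin (product_topology (\<lambda>_. euclidean) UNIV) {f :: 'a \<Rightarrow> complex. \<forall>x. cmod (f x) \<le> q x}"
    by (simp add: euclidean_product_topology)
  then show ?thesis
    unfolding gelfand_topology_def closedin_subtopology by blast
qed

lemma weakly_regular_functionally_continuous:
  assumes p: "functionally_continuous smul p" "weakly_regular smul p"
    and q: "algebra_norm smul q"
    and separating: "\<And>x. x \<noteq> 0 \<Longrightarrow> \<exists>f\<in>characters smul. (\<forall>y. cmod (f y) \<le> q y) \<and> f x \<noteq> 0"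
  shows "functionally_continuous smul q"
proof -
  interpret q: algebra_norm smul q by (rule q)
  define K where "K = {f \<in> continuous_characters smul p. \<forall>x. cmod (f x) \<le> q x}"
  have "K = continuous_characters smul p"
  proof (rule ccontr)
    assume "K \<noteq> continuous_characters smul p"
    moreover have "closedin (gelfand_topology smul p) K"
      unfolding K_def by (rule closedin_dominated_characters)
    ultimately have "\<exists>x. x \<noteq> 0 \<and> (\<forall>f\<in>K. f x = 0)"
      using p(2)[unfolded weakly_regular_def, THEN spec, of K] by simp
    then obtain x where x: "x \<noteq> 0" "\<forall>f\<in>K. f x = 0" by (elim exE conjE)
    obtain f where f: "f \<in> characters smul" "\<forall>y. cmod (f y) \<le> q y" "f x \<noteq> 0"
      using separating[OF x(1)] by blast
    \<comment> \<open>Functional continuity of \<open>p\<close> makes \<open>f\<close> continuous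
      for \<open>p\<close>; domination by \<open>q\<close> alone would not place it in the space
      where \<open>K\<close> lives.\<close>
    then have "f \<in> K" using p(1) by (simp add: functionally_continuous_def K_def)
    with x(2) f(3) show False by blast
  qed
  then have "characters smul \<subseteq> continuous_characters smul q"
    using p(1) q.continuous_characters_iff unfolding functionally_continuous_def K_def by auto
  then show ?thesis
    unfolding functionally_continuous_def continuous_characters_def by auto
qed

text \<open>A character whose modulus at \<open>x\<close> is \<open>p x\<close> exists by
  uniformity; being continuous for \<open>q\<close>, it is bounded by \<open>q\<close>.\<close>

lemma uniform_norm_le_functionally_continuous:
  assumes p: "algebra_norm smul p" "uniform_norm p"
    and q: "algebra_norm smul q" "functionally_continuous smul q"
  shows "p x \<le> q x"
proof (cases "p x = 0")
  case True
  then show ?thesis using algebra_norm.nonneg[OF q(1)] by simp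
next
  case False
  interpret p: algebra_norm smul p by (rule p(1))
  interpret p: commutative_algebra_norm smul p
    using p.uniform_norm_commute[OF p(2)] by unfold_locales
  have "0 < p x" using False by (simp add: less_le)
  then obtain f where "f \<in> characters smul" "cmod (f x) = p x"
    using p.uniform_character_exists[OF p(2)] by blast
  then show ?thesis
    using algebra_norm.continuous_characters_iff[OF q(1)] q(2)
    unfolding functionally_continuous_def by metis
qed

theorem theorem3p6:
  fixes smul :: "complex \<Rightarrow> 'a::ring_1 \<Rightarrow> 'a"
    and p q :: "'a \<Rightarrow> real"
  assumes "algebra_norm smul p"
    and "uniform_norm p"
    and "functionally_continuous smul p"
    and "weakly_regular smul p"
    and "algebra_norm smul q"
  shows "(functionally_continuous smul q \<longrightarrow> (\<forall>x. p x \<le> q x))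
    \<and> (semisimple_norm q \<longrightarrow>
        functionally_continuous smul q \<and> (\<forall>x. p x \<le> q x) \<and>
        (continuous_map (norm_topology p) euclideanreal q \<longrightarrow> equivalent_norms q p))
    \<and> (uniform_norm q \<longrightarrow> q = p)"
proof (intro conjI impI)
  interpret p: algebra_norm smul p by fact
  interpret q: algebra_norm smul q by fact
  \<comment> \<open>Commutativity is a property of the ring alone, so the uniformity of
    \<open>p\<close> yields it for \<open>q\<close> too.\<close>
  interpret q: commutative_algebra_norm smul q
    using p.uniform_norm_commute[OF assms(2)] by unfold_locales
  show le: "\<forall>x. p x \<le> q x" if "functionally_continuous smul q"
    using uniform_norm_le_functionally_continuous[OF assms(1,2,5) that] by blast
  show fc: "functionally_continuous smul q" if "semisimple_norm q"
    using weakly_regular_functionally_continuous[OF assms(3,4,5)]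
      q.semisimple_character_exists[OF that] by metis
  then show "\<forall>x. p x \<le> q x" if "semisimple_norm q" using le that by blast
  show "equivalent_norms q p"
    if semisimple: "semisimple_norm q" and cont: "continuous_map (norm_topology p) euclideanreal q"
  proof -
    obtain C where C: "0 < C" "\<And>x. q x \<le> C * p x"
      using p.continuous_norm_bound[OF assms(5) cont] by blast
    have "\<forall>x. 1 / C * q x \<le> p x \<and> p x \<le> 1 * q x"
      using C le[OF fc[OF semisimple]] by (simp add: field_simps)
    then show ?thesis
      unfolding equivalent_norms_def using C(1) by (meson zero_less_divide_1_iff zero_less_one)
  qed
  show "q = p" if u: "uniform_norm q"
  proof -
    have "\<exists>f\<in>characters smul. (\<forall>y. cmod (f y) \<le> q y) \<and> f x \<noteq> 0" if "x \<noteq> 0" for x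
    proof -
      have "0 < q x" using that q.eq_zero_iff q.nonneg[of x] by (simp add: less_le)
      then show ?thesis using q.uniform_character_exists[OF u] by (metis norm_eq_zero less_irrefl)
    qed
    then have "functionally_continuous smul q"
      by (rule weakly_regular_functionally_continuous[OF assms(3,4,5)])
    \<comment> \<open>Both norms are now uniform and functionally continuous, so the comparison
      applies with the roles exchanged.\<close>
    then show ?thesis
      using uniform_norm_le_functionally_continuous[OF assms(1,2,5)]
        uniform_norm_le_functionally_continuous[OF assms(5) u assms(1,3)]
      by (intro ext antisym)
  qed
qed

end
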